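(* Let $0<a<\infty$, let $k(z)$ be analytic in the interval $[0,a]$ with $k(0)\neq0$, and let $n$ be a positive integer. Then for all positive integers $\mathfrak{b}$, $$\mathrm{f.p.}\!\int_0^a\frac{k(t)\ln^n t}{t^{\mathfrak{b}}}\,dt=\frac{1}{2\pi i\,(n+1)}\int_C\frac{k(z)}{z^{\mathfrak{b}}}\ln^{n+1}z\,dz+\sum_{j=0}^{n}\binom{n}{j}(2\pi i)^{n-j}\,\frac{B_{n-j+1}}{n-j+1}\int_C\frac{k(z)}{z^{\mathfrak{b}}}\ln^{j}z\,dz,$$ where $B_{n-j+1}$ is the Bernoulli number.
   Context: Analytic in $[0,a]$ means that $k$ has a complex extension analytic in an open neighbourhood of $[0,a]$ in $\mathbb{C}$. Finite-part integral (written f.p. here; the paper uses a double-slashed integral sign): for $0<\epsilon<a$ write $\int_\epsilon^a k(t)t^{-\mathfrak{b}}\ln^n t\,dt=C_\epsilon+D_\epsilon$, where $C_\epsilon$ converges and $D_\epsilon$ collects the diverging terms as $\epsilon\to0^+$, i.e. $D_\epsilon$ is a finite linear combination of functions $\epsilon^{-\mu}\ln^m\epsilon$ with $\mathrm{Re}\,\mu\ge0$, $m\in\mathbb{N}_0$, $(\mu,m)\ne(0,0)$. Then $\mathrm{f.p.}\int_0^a k(t)t^{-\mathfrak{b}}\ln^n t\,dt:=\lim_{\epsilon\to0^+}C_\epsilon$. Branches: $\ln z=\ln|z|+i\arg z$ with $0\le\arg z<2\pi$, branch cut along the positive real axis; on the upper side of the cut $\ln z=\ln t$, on the lower side the limiting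 value is $\ln z=\ln t+2\pi i$. Contour $C$: it starts at $a$ on the upper side of the branch cut, goes once counterclockwise around the origin, straddling the cut $[0,a]$, and ends at $a$ on the lower side of the cut. It lies in the region where $k$ is analytic, encloses no pole of $k(z)$ and crosses no branch cut of $k(z)$. Bernoulli numbers: $\frac{x}{e^x-1}=\sum_{m\ge0}B_m\frac{x^m}{m!}$, so $B_1=-\tfrac12$.
   Formalization: The contour C is required to enclose no singularity of k of any kind, not only no pole: enclosed essential singularities and enclosed uncrossed branch cuts are excluded too, since the formula fails there, e.g. for k(z)=exp(s/(z-c)) with c enclosed by C. *)

theory Defs
  imports "HOL-Complex_Analysis.Complex_Analysis" "HOL-Real_Asymp.Real_Asymp"
begin

section \<open>Hadamard finite part\<close>

text \<open>
  A finite combination of the divergent terms \<open>\<epsilon> powr (-\<mu>) * (ln \<epsilon>) ^ m\<close>, where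
  \<open>Re \<mu> \<ge> 0\<close> and \<open>(\<mu>, m) \<noteq> (0, 0)\<close>.  Only positive \<open>\<epsilon>\<close> matters, where the complex \<open>powr\<close>
  is \<open>exp (-\<mu> * ln \<epsilon>)\<close> with the real logarithm.
\<close>

definition divergent_terms :: "(real \<Rightarrow> complex) \<Rightarrow> bool" where
  "divergent_terms D \<longleftrightarrow>
     (\<exists>(S :: (complex \<times> nat) set) c.
        finite S \<and> (\<forall>(\<mu>, m)\<in>S. 0 \<le> Re \<mu> \<and> (\<mu>, m) \<noteq> (0, 0)) \<and>
        D = (\<lambda>\<epsilon>. \<Sum>(\<mu>, m)\<in>S. c (\<mu>, m) * (of_real \<epsilon> powr (- \<mu>) * of_real (ln \<epsilon>) ^ m)))"

definition has_finite_part_integral :: "(real \<Rightarrow> complex) \<Rightarrow> complex \<Rightarrow> real \<Rightarrow> bool" where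
  "has_finite_part_integral f L a \<longleftrightarrow>
     (\<forall>\<epsilon>\<in>{0<..<a}. f integrable_on {\<epsilon>..a}) \<and>
     (\<exists>C D. (\<forall>\<epsilon>\<in>{0<..<a}. integral {\<epsilon>..a} f = C \<epsilon> + D \<epsilon>) \<and>
            divergent_terms D \<and> (C \<longlongrightarrow> L) (at_right 0))"

text \<open>
  The finite part does not depend on the decomposition: an exponential polynomial
  \<open>\<Sum>\<mu>. exp (\<mu> x) P\<^sub>\<mu>(x)\<close> with all \<open>Re \<mu> \<ge> 0\<close> that tends to 0 at infinity is trivial
  (substitute \<open>x = - ln \<epsilon>\<close>).
\<close>

lemma exp_poly_tendsto_0:
  fixes P :: "complex \<Rightarrow> complex poly"
  assumes "finite M" "\<And>\<mu>. \<mu> \<in> M \<Longrightarrow> 0 \<le> Re \<mu>" "\<And>\<mu>. \<mu> \<in> M \<Longrightarrow> P \<mu> \<noteq> 0"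
    and "((\<lambda>x::real. \<Sum>\<mu>\<in>M. exp (\<mu> * of_real x) * poly (P \<mu>) (of_real x)) \<longlongrightarrow> 0) at_top"
  shows "M = {}"
  using assms
proof (induction "\<Sum>\<mu>\<in>M. Suc (degree (P \<mu>))" arbitrary: M P rule: less_induct)
  case less
  note fin = less.prems(1) and Re = less.prems(2) and nz = less.prems(3) and lim = less.prems(4)
  define f where "f = (\<lambda>x::real. \<Sum>\<mu>\<in>M. exp (\<mu> * of_real x) * poly (P \<mu>) (of_real x))"
  have limf: "(f \<longlongrightarrow> 0) at_top" using lim by (simp add: f_def)
  show ?case
  proof (rule ccontr)
    assume "M \<noteq> {}"
    then obtain \<nu> where \<nu>: "\<nu> \<in> M" by blast
    obtain h :: real where h: "h > 0" "\<And>\<mu>. \<mu> \<in> M - {\<nu>} \<Longrightarrow> exp (\<mu> * of_real h) \<noteq> exp (\<nu> * of_real h)"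
    proof -
      define B where "B = Max (insert 1 ((\<lambda>\<mu>. cmod (\<mu> - \<nu>)) ` M))"
      have B: "B \<ge> 1" "\<And>\<mu>. \<mu> \<in> M \<Longrightarrow> cmod (\<mu> - \<nu>) \<le> B"
        using fin by (auto simp: B_def)
      have *: "exp (\<mu> * of_real (1/B)) \<noteq> exp (\<nu> * of_real (1/B))" if "\<mu> \<in> M - {\<nu>}" for \<mu>
      proof
        assume eq: "exp (\<mu> * of_real (1/B)) = exp (\<nu> * of_real (1/B))"
        have "\<bar>Im \<mu> - Im \<nu>\<bar> \<le> B"
          using B(2)[of \<mu>] that abs_Im_le_cmod[of "\<mu> - \<nu>"] by auto
        then have "\<bar>Im (\<mu> * of_real (1/B)) - Im (\<nu> * of_real (1/B))\<bar> \<le> 1"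
          using B(1) by (simp add: divide_simps flip: diff_divide_distrib)
        also have "1 < 2 * pi" using pi_gt3 by simp
        finally have "\<mu> * of_real (1/B) = \<nu> * of_real (1/B)"
          using exp_complex_eqI[OF _ eq] by simp
        then show False using that B(1) by simp
      qed
      show ?thesis by (rule that[of "1/B"]) (use B(1) * in auto)
    qed
    define Q where "Q = (\<lambda>\<mu>. smult (exp (\<mu> * of_real h)) (pcompose (P \<mu>) [:of_real h, 1:])
                               - smult (exp (\<nu> * of_real h)) (P \<mu>))"
    define M' where "M' = {\<mu>\<in>M. Q \<mu> \<noteq> 0}"
    have degc: "degree (pcompose (P \<mu>) [:of_real h, 1:]) = degree (P \<mu>)" for \<mu>
      by (simp add: degree_pcompose)
    have lcc: "coeff (pcompose (P \<mu>) [:of_real h, 1:]) (degree (P \<mu>)) = lead_coeff (P \<mu>)" for \<mu>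
      using lead_coeff_comp[of "[:of_real h, 1:]" "P \<mu>"] degc[of \<mu>] by simp
    have degQ: "degree (Q \<mu>) \<le> degree (P \<mu>)" for \<mu>
      unfolding Q_def by (intro degree_diff_le order.trans[OF degree_smult_le]) (simp_all add: degc)
    have coeffQ: "coeff (Q \<mu>) (degree (P \<mu>)) =
        (exp (\<mu> * of_real h) - exp (\<nu> * of_real h)) * lead_coeff (P \<mu>)" for \<mu>
      by (simp add: Q_def lcc algebra_simps)
    have degQ\<nu>: "degree (Q \<nu>) < degree (P \<nu>)" if "Q \<nu> \<noteq> 0"
      using degQ[of \<nu>] coeffQ[of \<nu>] that
      by (metis diff_self le_neq_implies_less leading_coeff_0_iff mult_zero_left)
    have other: "Q \<mu> \<noteq> 0" if "\<mu> \<in> M - {\<nu>}" for \<mu>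
      using coeffQ[of \<mu>] h(2)[OF that] nz[of \<mu>] that by auto
    have sumeq: "(\<Sum>\<mu>\<in>M'. exp (\<mu> * of_real x) * poly (Q \<mu>) (of_real x))
        = f (x + h) - exp (\<nu> * of_real h) * f x" for x
    proof -
      have "(\<Sum>\<mu>\<in>M'. exp (\<mu> * of_real x) * poly (Q \<mu>) (of_real x))
          = (\<Sum>\<mu>\<in>M. exp (\<mu> * of_real x) * poly (Q \<mu>) (of_real x))"
        using fin by (intro sum.mono_neutral_left) (auto simp: M'_def)
      also have "\<dots> = f (x + h) - exp (\<nu> * of_real h) * f x"
        unfolding f_def sum_distrib_left sum_subtractf[symmetric]
        by (intro sum.cong refl)
           (simp add: Q_def poly_pcompose exp_add algebra_simps)
      finally show ?thesis .
    qed
    have shift: "((\<lambda>x. f (x + h)) \<longlongrightarrow> 0) at_top"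
      by (rule filterlim_compose[OF limf])
         (rule filterlim_at_top_add_at_top filterlim_tendsto_add_at_top filterlim_ident
            filterlim_at_top_mono[OF filterlim_ident], use h in auto)
    have "((\<lambda>x. f (x + h) - exp (\<nu> * of_real h) * f x) \<longlongrightarrow> 0 - exp (\<nu> * of_real h) * 0) at_top"
      by (intro tendsto_intros shift limf)
    then have lim': "((\<lambda>x. \<Sum>\<mu>\<in>M'. exp (\<mu> * of_real x) * poly (Q \<mu>) (of_real x)) \<longlongrightarrow> 0) at_top"
      by (simp add: sumeq)
    have "(\<Sum>\<mu>\<in>M'. Suc (degree (Q \<mu>))) \<le> (\<Sum>\<mu>\<in>M' - {\<nu>}. Suc (degree (P \<mu>))) + degree (P \<nu>)"
    proof -
      have "(\<Sum>\<mu>\<in>M' - {\<nu>}. Suc (degree (Q \<mu>))) \<le> (\<Sum>\<mu>\<in>M' - {\<nu>}. Suc (degree (P \<mu>)))"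
        using degQ by (intro sum_mono) auto
      moreover have "finite M'" using fin by (simp add: M'_def)
      ultimately show ?thesis
      proof (cases "\<nu> \<in> M'")
        case True
        then have "Suc (degree (Q \<nu>)) \<le> degree (P \<nu>)" using degQ\<nu> by (simp add: M'_def)
        then show ?thesis
          using sum.remove[OF \<open>finite M'\<close> True, of "\<lambda>\<mu>. Suc (degree (Q \<mu>))"]
            \<open>(\<Sum>\<mu>\<in>M' - {\<nu>}. Suc (degree (Q \<mu>))) \<le> _\<close> by linarith
      qed simp
    qed
    also have "\<dots> \<le> (\<Sum>\<mu>\<in>M - {\<nu>}. Suc (degree (P \<mu>))) + degree (P \<nu>)"
      using fin by (intro add_right_mono sum_mono2) (auto simp: M'_def)
    also have "\<dots> < (\<Sum>\<mu>\<in>M. Suc (degree (P \<mu>)))"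
      using sum.remove[OF fin \<nu>, of "\<lambda>\<mu>. Suc (degree (P \<mu>))"] by linarith
    finally have "M' = {}"
      by (rule less.hyps) (use fin Re lim' in \<open>auto simp: M'_def\<close>)
    then have M: "M = {\<nu>}" and Q0: "Q \<nu> = 0"
      using other \<nu> by (auto simp: M'_def)
    have per: "poly (P \<nu>) (z + of_real h) = poly (P \<nu>) z" for z
      using arg_cong[OF Q0, of "\<lambda>p. poly p z"] by (simp add: Q_def poly_pcompose add.commute)
    have per': "poly (P \<nu>) (of_nat n * of_real h) = poly (P \<nu>) 0" for n
    proof (induction n)
      case (Suc n)
      then show ?case using per[of "of_nat n * of_real h"] by (simp add: algebra_simps)
    qed simp
    have "P \<nu> - [:poly (P \<nu>) 0:] = 0"
    proof (rule ccontr)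
      assume "P \<nu> - [:poly (P \<nu>) 0:] \<noteq> 0"
      then have "finite {z. poly (P \<nu> - [:poly (P \<nu>) 0:]) z = 0}" by (rule poly_roots_finite)
      moreover have "range (\<lambda>n::nat. of_nat n * of_real h) \<subseteq> {z. poly (P \<nu> - [:poly (P \<nu>) 0:]) z = 0}"
        using per' by auto
      moreover have "inj (\<lambda>n::nat. of_nat n * of_real h :: complex)"
        using h(1) by (auto simp: inj_on_def)
      ultimately show False
        using finite_subset range_inj_infinite by blast
    qed
    then have Pc: "P \<nu> = [:poly (P \<nu>) 0:]" by simp
    define c where "c = poly (P \<nu>) 0"
    have c: "c \<noteq> 0" using nz[OF \<nu>] Pc by (auto simp: c_def)
    have fc: "f x = exp (\<nu> * of_real x) * c" for x
    proof -
      have "f x = exp (\<nu> * of_real x) * poly (P \<nu>) (of_real x)" by (simp add: f_def M)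
      also have "poly (P \<nu>) (of_real x) = c" by (subst Pc) (simp add: c_def)
      finally show ?thesis .
    qed
    have "eventually (\<lambda>x. cmod (f x) < cmod c) at_top"
      using tendstoD[OF limf, of "cmod c"] c by simp
    then have "eventually (\<lambda>x. cmod (f x) < cmod c \<and> x \<ge> 0) at_top"
      using eventually_ge_at_top eventually_conj by blast
    then obtain x where x: "cmod (f x) < cmod c" "x \<ge> 0"
      using eventually_happens trivial_limit_at_top_linorder by blast
    have "1 * cmod c \<le> cmod (f x)"
      unfolding fc norm_mult using Re[OF \<nu>] x(2) by (intro mult_right_mono) auto
    with x(1) show False by simp
  qed
qed

lemma divergent_terms_tendsto:
  assumes D: "divergent_terms D" "divergent_terms D'"
    and lim: "((\<lambda>\<epsilon>. D \<epsilon> - D' \<epsilon>) \<longlongrightarrow> L) (at_right 0)"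
  shows "L = 0"
proof -
  obtain S c where S: "finite S" "\<forall>(\<mu>, m)\<in>S. 0 \<le> Re \<mu> \<and> (\<mu>, m) \<noteq> (0, 0)"
    and Deq: "D = (\<lambda>\<epsilon>. \<Sum>(\<mu>, m)\<in>S. c (\<mu>, m) * (of_real \<epsilon> powr (- \<mu>) * of_real (ln \<epsilon>) ^ m))"
    using D(1) unfolding divergent_terms_def by blast
  obtain S' c' where S': "finite S'" "\<forall>(\<mu>, m)\<in>S'. 0 \<le> Re \<mu> \<and> (\<mu>, m) \<noteq> (0, 0)"
    and Deq': "D' = (\<lambda>\<epsilon>. \<Sum>(\<mu>, m)\<in>S'. c' (\<mu>, m) * (of_real \<epsilon> powr (- \<mu>) * of_real (ln \<epsilon>) ^ m))"
    using D(2) unfolding divergent_terms_def by blast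
  define T where "T = insert (0, 0) (S \<union> S')"
  define d where "d = (\<lambda>p. (if p \<in> S then c p else 0) - (if p \<in> S' then c' p else 0)
                           - (if p = (0, 0) then L else 0))"
  have finT: "finite T" using S S' by (simp add: T_def)
  define M where "M = fst ` T"
  define P where "P = (\<lambda>\<mu>. \<Sum>m\<in>{m. (\<mu>, m) \<in> T}. monom (d (\<mu>, m) * (- 1) ^ m) m)"
  define N where "N = {\<mu>\<in>M. P \<mu> \<noteq> 0}"
  have finM: "finite M" using finT by (simp add: M_def)
  have finTm: "finite {m. (\<mu>, m) \<in> T}" for \<mu>
    by (rule finite_subset[of _ "snd ` T"]) (use finT in force)+
  have eq: "D (exp (- x)) - D' (exp (- x)) - L = (\<Sum>\<mu>\<in>N. exp (\<mu> * of_real x) * poly (P \<mu>) (of_real x))"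
    for x :: real
  proof -
    define u where "u = (\<lambda>(\<mu>::complex, m::nat). exp (\<mu> * of_real x) * ((- 1) ^ m * complex_of_real x ^ m))"
    have u: "of_real (exp (- x)) powr (- \<mu>) * of_real (ln (exp (- x))) ^ m = u (\<mu>, m)" for \<mu> m
    proof -
      have "complex_of_real (exp (- x)) powr (- \<mu>) = exp (\<mu> * of_real x)"
        unfolding powr_def by (subst Ln_of_real) auto
      then show ?thesis by (simp add: u_def power_minus[of "complex_of_real x"])
    qed
    have D1: "D (exp (- x)) = (\<Sum>p\<in>T. (if p \<in> S then c p else 0) * u p)"
      unfolding Deq by (rule sum.mono_neutral_cong_left[OF finT]) (auto simp: T_def simp flip: u)
    have D2: "D' (exp (- x)) = (\<Sum>p\<in>T. (if p \<in> S' then c' p else 0) * u p)"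
      unfolding Deq' by (rule sum.mono_neutral_cong_left[OF finT]) (auto simp: T_def simp flip: u)
    have L: "L = (\<Sum>p\<in>T. (if p = (0, 0) then L else 0) * u p)"
    proof -
      have "(\<Sum>p\<in>T. (if p = (0, 0) then L else 0) * u p) = (\<Sum>p\<in>{(0,0)}. L * u p)"
        by (rule sum.mono_neutral_cong_right[OF finT]) (auto simp: T_def)
      then show ?thesis by (simp add: u_def)
    qed
    have "D (exp (- x)) - D' (exp (- x)) - L = (\<Sum>p\<in>T. d p * u p)"
      unfolding D1 D2 by (subst L) (simp only: d_def left_diff_distrib sum_subtractf)
    also have "T = Sigma M (\<lambda>\<mu>. {m. (\<mu>, m) \<in> T})" by (force simp: M_def)
    also have "(\<Sum>p\<in>\<dots>. d p * u p) = (\<Sum>\<mu>\<in>M. \<Sum>m\<in>{m. (\<mu>, m) \<in> T}. d (\<mu>, m) * u (\<mu>, m))"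
      using finM finTm by (subst sum.Sigma) (auto simp: case_prod_unfold)
    also have "\<dots> = (\<Sum>\<mu>\<in>M. exp (\<mu> * of_real x) * poly (P \<mu>) (of_real x))"
      by (intro sum.cong refl)
         (simp add: P_def poly_sum poly_monom u_def sum_distrib_left algebra_simps)
    also have "\<dots> = (\<Sum>\<mu>\<in>N. exp (\<mu> * of_real x) * poly (P \<mu>) (of_real x))"
      using finM by (intro sum.mono_neutral_right) (auto simp: N_def)
    finally show ?thesis .
  qed
  have "filterlim (\<lambda>x::real. exp (- x)) (at_right 0) at_top"
    by real_asymp
  then have "((\<lambda>x. D (exp (- x)) - D' (exp (- x))) \<longlongrightarrow> L) at_top"
    by (rule filterlim_compose[OF lim])
  then have "((\<lambda>x. D (exp (- x)) - D' (exp (- x)) - L) \<longlongrightarrow> L - L) at_top"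
    by (intro tendsto_intros)
  then have "N = {}"
    unfolding eq
    by (intro exp_poly_tendsto_0[of N P]) (use finM S S' in \<open>auto simp: N_def M_def T_def\<close>)
  then have "P 0 = 0" by (force simp: N_def M_def T_def)
  then have "coeff (P 0) 0 = 0" by simp
  also have "coeff (P 0) 0 = d (0, 0)"
  proof -
    have "coeff (P 0) 0 = (\<Sum>m\<in>{m. (0, m) \<in> T}. if m = 0 then d (0, 0) else 0)"
      unfolding P_def coeff_sum by (intro sum.cong) auto
    then show ?thesis using finTm[of 0] by (simp add: T_def)
  qed
  finally show "L = 0" using S S' by (auto simp: d_def)
qed

lemma has_finite_part_integral_unique:
  assumes "has_finite_part_integral f L a" "has_finite_part_integral f L' a" "0 < a"
  shows "L = L'"
proof -
  obtain C D where CD: "\<forall>\<epsilon>\<in>{0<..<a}. integral {\<epsilon>..a} f = C \<epsilon> + D \<epsilon>" "divergent_terms D"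
      "(C \<longlongrightarrow> L) (at_right 0)"
    using assms(1) unfolding has_finite_part_integral_def by blast
  obtain C' D' where CD': "\<forall>\<epsilon>\<in>{0<..<a}. integral {\<epsilon>..a} f = C' \<epsilon> + D' \<epsilon>" "divergent_terms D'"
      "(C' \<longlongrightarrow> L') (at_right 0)"
    using assms(2) unfolding has_finite_part_integral_def by blast
  have ev: "\<forall>\<^sub>F \<epsilon> in at_right 0. C' \<epsilon> - C \<epsilon> = D \<epsilon> - D' \<epsilon>"
    using eventually_at_right_less[of "0::real"] eventually_at_right_real[OF \<open>0 < a\<close>]
  proof eventually_elim
    case (elim \<epsilon>)
    then have "C \<epsilon> + D \<epsilon> = C' \<epsilon> + D' \<epsilon>" using CD(1) CD'(1) by metis
    then show ?case by (simp add: algebra_simps)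
  qed
  have "((\<lambda>\<epsilon>. C' \<epsilon> - C \<epsilon>) \<longlongrightarrow> L' - L) (at_right 0)"
    by (intro tendsto_intros CD CD')
  then have "((\<lambda>\<epsilon>. D \<epsilon> - D' \<epsilon>) \<longlongrightarrow> L' - L) (at_right 0)"
    using tendsto_cong[OF ev] by blast
  from divergent_terms_tendsto[OF CD(2) CD'(2) this] show ?thesis by simp
qed

text \<open>The finite part integral as a value; meaningful when it exists.\<close>

definition finite_part_integral :: "real \<Rightarrow> (real \<Rightarrow> complex) \<Rightarrow> complex" where
  "finite_part_integral a f = (THE L. has_finite_part_integral f L a)"

lemma finite_part_integral_eqI:
  assumes "has_finite_part_integral f L a" "0 < a"
  shows "finite_part_integral a f = L"
  unfolding finite_part_integral_def
  using assms has_finite_part_integral_unique by blast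


section \<open>Logarithm and contour\<close>

text \<open>The branch with \<open>0 \<le> arg z < 2 \<pi>\<close>; on the cut it takes the value from the upper side.\<close>

definition ln_cut :: "complex \<Rightarrow> complex" where
  "ln_cut z = of_real (ln (cmod z)) + \<i> * of_real (Arg2pi z)"

text \<open>
  The contour meets the cut \<open>[0, \<infinity>)\<close> of \<^const>\<open>ln_cut\<close> only in its two endpoints, both \<open>a\<close>;
  it leaves \<open>a\<close> above the cut and comes back to it below.  It need not be simple: the enclosed
  points are those of nonzero winding number, and \<open>k\<close> has no singularity of any kind (in
  particular no pole or branch cut) on the contour or at an enclosed point.
\<close>

definition cut_contour :: "(complex \<Rightarrow> complex) \<Rightarrow> real \<Rightarrow> (real \<Rightarrow> complex) \<Rightarrow> bool" where
  "cut_contour k a g \<longleftrightarrow>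
     valid_path g \<and> pathstart g = of_real a \<and> pathfinish g = of_real a \<and>
     (\<forall>t\<in>{0<..<1}. g t \<notin> \<real>\<^sub>\<ge>\<^sub>0) \<and>
     (\<forall>\<^sub>F t in at_right 0. Im (g t) > 0) \<and>
     (\<forall>\<^sub>F t in at_left 1. Im (g t) < 0) \<and>
     winding_number g 0 = 1 \<and>
     k analytic_on path_image g \<and>
     k analytic_on {w. w \<notin> path_image g \<and> winding_number g w \<noteq> 0}"


section \<open>Bernoulli numbers\<close>

text \<open>Exponential generating function \<open>x / (e\<^sup>x - 1)\<close>, so that \<open>B\<^sub>1 = -1/2\<close>.\<close>

definition bernoulli :: "nat \<Rightarrow> real" where
  "bernoulli m = fact m * fps_nth (fps_X / (fps_exp 1 - 1)) m"

lemma bernoulli_egf: "Abs_fps (\<lambda>m. bernoulli m / fact m) * (fps_exp 1 - 1) = fps_X"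
proof -
  have ne: "fps_exp (1::real) - 1 \<noteq> 0"
  proof
    assume "fps_exp (1::real) - 1 = 0"
    then have "fps_nth (fps_exp (1::real) - 1) 1 = 0" by (simp only: fps_zero_nth)
    then show False by simp
  qed
  have "subdegree (fps_exp (1::real) - 1) = 1"
    by (rule subdegreeI) (auto simp: fps_eq_iff)
  then have "(fps_exp (1::real) - 1) dvd fps_X"
    using ne by (subst fps_dvd_iff) auto
  moreover have "Abs_fps (\<lambda>m. bernoulli m / fact m) = fps_X / (fps_exp 1 - 1)"
    by (simp add: fps_eq_iff bernoulli_def)
  ultimately show ?thesis by simp
qed

end

(*
  The right-hand side is the integral over C of k(z) z^-b Q(ln z), where Q is the rescaled Bernoulli
  polynomial (2 pi i)^n / (n+1) B_(n+1)(x / (2 pi i)).  It satisfies Q(x + 2 pi i) - Q(x) = x^n, and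
  its integral from 0 to 2 pi i vanishes.

  Under z = exp w the contour becomes a path w from ln a to ln a + 2 pi i, which is closed up by the
  segments to ln eps + 2 pi i, to ln eps and back to ln a.  The integrand k(exp w) exp((1-b) w) Q(w) is
  holomorphic where exp w is a point of analyticity of k, and the closed path has winding number 0
  around all other points, so Cauchy's theorem applies.  By the shift property the two horizontal
  segments together contribute the integral of k(t) t^-b (ln t)^n over [eps, a].  On the vertical
  segment, i.e. the circle of radius eps, the Taylor expansion of k gives terms eps^-p (ln eps)^i plus
  a remainder that tends to 0; the only possible constant term, p = i = 0, is a multiple of the
  integral of Q from 0 to 2 pi i, which is 0.  Hence the finite part is exactly the integral over C.
*)
theory Submission
  imports Defs
begin

section \<open>Bernoulli polynomials\<close>

text \<open>Compares the coefficients of x^m in \<open>bernoulli_egf\<close> and multiplies by m!.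
  The term \<open>l = m\<close> drops out because e^x - 1 has no constant coefficient.\<close>

lemma bernoulli_recurrence:
  "(\<Sum>l<m. of_nat (m choose l) * bernoulli l) = (if m = 1 then 1 else 0)"
proof -
  have "(\<Sum>l\<le>m. bernoulli l / fact l * fps_nth (fps_exp 1 - 1) (m - l)) = fps_nth fps_X m"
    using arg_cong[OF bernoulli_egf, of "\<lambda>f. fps_nth f m"]
    by (simp add: fps_mult_nth atLeast0AtMost)
  also have "(\<Sum>l\<le>m. bernoulli l / fact l * fps_nth (fps_exp 1 - 1) (m - l)) =
      (\<Sum>l<m. bernoulli l / fact l * fps_nth (fps_exp 1 - 1) (m - l))"
    by (intro sum.mono_neutral_right) (auto simp: not_less)
  also have "\<dots> = (\<Sum>l<m. of_nat (m choose l) * bernoulli l / fact m)"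
    by (intro sum.cong refl) (auto simp: binomial_fact field_simps)
  finally have "(\<Sum>l<m. of_nat (m choose l) * bernoulli l) = fact m * fps_nth fps_X m"
    by (simp add: field_simps flip: sum_divide_distrib)
  then show ?thesis by auto
qed

text \<open>The classical Bernoulli polynomial B_n(y), ordered by powers of
  \<open>y\<close>.\<close>

definition bernpoly :: "nat \<Rightarrow> complex \<Rightarrow> complex" where
  "bernpoly n y = (\<Sum>j\<le>n. of_nat (n choose j) * of_real (bernoulli (n - j)) * y ^ j)"

text \<open>Expanding the powers of \<open>y + 1\<close> and collecting by \<open>y ^ i\<close>
  leaves \<open>n choose i\<close> times the recurrence sum of order \<open>n - i\<close>, which is
  nonzero only for \<open>i = n - 1\<close>.\<close>

lemma bernpoly_diff: "bernpoly n (y + 1) - bernpoly n y = of_nat n * y ^ (n - 1)"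
proof -
  define c where "c = (\<lambda>j. of_nat (n choose j) * complex_of_real (bernoulli (n - j)))"
  have "bernpoly n (y + 1) - bernpoly n y = (\<Sum>j\<le>n. c j * ((y + 1) ^ j - y ^ j))"
    by (simp add: bernpoly_def c_def sum_subtractf algebra_simps)
  also have "\<dots> = (\<Sum>j\<le>n. \<Sum>i<j. c j * of_nat (j choose i) * y ^ i)"
  proof (intro sum.cong refl)
    fix j
    have "(y + 1) ^ j - y ^ j = (\<Sum>i<j. of_nat (j choose i) * y ^ i)"
      unfolding binomial_ring by (simp flip: lessThan_Suc_atMost)
    then show "c j * ((y + 1) ^ j - y ^ j) = (\<Sum>i<j. c j * of_nat (j choose i) * y ^ i)"
      by (simp add: sum_distrib_left mult.assoc)
  qed
  also have "\<dots> = (\<Sum>i<n. \<Sum>j\<in>{i<..n}. c j * of_nat (j choose i) * y ^ i)"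
    unfolding sum.Sigma[OF finite_atMost ballI[OF finite_lessThan]] sum.Sigma[OF finite_lessThan ballI[OF finite_greaterThanAtMost]]
    by (rule sum.reindex_bij_witness[of _ "\<lambda>(i,j). (j,i)" "\<lambda>(i,j). (j,i)"]) auto
  also have "\<dots> = (\<Sum>i<n. of_nat (n choose i) * y ^ i * (if n - i = 1 then 1 else 0))"
  proof (intro sum.cong refl)
    fix i assume "i \<in> {..<n}"
    then have i: "i < n" by simp
    have "(\<Sum>j\<in>{i<..n}. c j * of_nat (j choose i) * y ^ i) =
        (\<Sum>l<n - i. of_nat (n choose i) * y ^ i * of_real (of_nat ((n - i) choose l) * bernoulli l))"
    proof (rule sum.reindex_bij_witness[of _ "\<lambda>l. n - l" "\<lambda>j. n - j"])
      fix j assume j: "j \<in> {i<..n}"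
      have "(n choose j) * (j choose i) = (n choose i) * ((n - i) choose (n - j))"
        using choose_mult[of i j n] binomial_symmetric[of "j - i" "n - i"] j by simp
      then have "complex_of_nat (n choose j) * of_nat (j choose i) =
          of_nat (n choose i) * of_nat ((n - i) choose (n - j))"
        by (metis of_nat_mult)
      then show "of_nat (n choose i) * y ^ i * of_real (of_nat ((n - i) choose (n - j)) * bernoulli (n - j)) =
          c j * of_nat (j choose i) * y ^ i"
        by (simp add: c_def)
    qed auto
    also have "\<dots> = of_nat (n choose i) * y ^ i * of_real (\<Sum>l<n - i. of_nat ((n - i) choose l) * bernoulli l)"
      by (simp add: sum_distrib_left)
    finally show "(\<Sum>j\<in>{i<..n}. c j * of_nat (j choose i) * y ^ i) =
        of_nat (n choose i) * y ^ i * (if n - i = 1 then 1 else 0)"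
      by (simp only: bernoulli_recurrence) simp
  qed
  also have "\<dots> = of_nat n * y ^ (n - 1)"
  proof (cases n)
    case (Suc m)
    have "(\<Sum>i<n. of_nat (n choose i) * y ^ i * (if n - i = 1 then 1 else 0)) =
        (\<Sum>i\<in>{m}. of_nat (n choose i) * y ^ i)"
      by (rule sum.mono_neutral_cong_right) (auto simp: Suc)
    then show ?thesis by (simp add: Suc)
  qed simp
  finally show ?thesis .
qed

text \<open>The primitive \<open>F\<close> vanishes at 0. Its value at 1 is, after absorbing
  \<open>1 / (j + 1)\<close> into the binomial, the recurrence sum of order \<open>n + 1\<close>,
  and that is 0 because \<open>n + 1\<close> is not 1.\<close>

lemma bernpoly_integral:
  assumes "n > 0"
  shows "(bernpoly n has_contour_integral 0) (linepath 0 1)"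
proof -
  define F where "F = (\<lambda>y::complex. \<Sum>j\<le>n. of_nat (n choose j) * of_real (bernoulli (n - j)) * y ^ Suc j / of_nat (Suc j))"
  have F: "(F has_field_derivative bernpoly n y) (at y within S)" for y S
    unfolding F_def bernpoly_def
  proof (rule DERIV_sum)
    fix j
    have "((\<lambda>y. y ^ Suc j) has_field_derivative of_nat (Suc j) * y ^ j) (at y within S)"
      using DERIV_power[OF DERIV_ident, of "Suc j"] by (simp add: ac_simps del: power_Suc of_nat_Suc)
    from DERIV_cmult[OF this, of "of_nat (n choose j) * of_real (bernoulli (n - j)) / of_nat (Suc j)"]
    show "((\<lambda>y. of_nat (n choose j) * of_real (bernoulli (n - j)) * y ^ Suc j / of_nat (Suc j))
        has_field_derivative of_nat (n choose j) * of_real (bernoulli (n - j)) * y ^ j) (at y within S)"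
      by (simp add: mult.assoc del: power_Suc of_nat_Suc)
  qed
  have "(bernpoly n has_contour_integral (F (pathfinish (linepath 0 1)) - F (pathstart (linepath 0 1)))) (linepath 0 1)"
    by (rule contour_integral_primitive[of UNIV, OF F valid_path_linepath subset_UNIV])
  also have "F (pathfinish (linepath 0 1)) - F (pathstart (linepath 0 1)) =
      (\<Sum>j\<le>n. of_real (of_nat (Suc n choose (n - j)) * bernoulli (n - j)) / of_nat (Suc n))"
  proof -
    have "complex_of_nat (n choose j) / of_nat (Suc j) = of_nat (Suc n choose (n - j)) / of_nat (Suc n)" if "j \<le> n" for j
    proof -
      have "Suc j * (Suc n choose (n - j)) = Suc n * (n choose j)"
        using that Suc_times_binomial_eq[of n j] binomial_symmetric[of "Suc j" "Suc n"]
        by (simp add: mult.commute)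
      then have "complex_of_nat (Suc j) * of_nat (Suc n choose (n - j)) = of_nat (Suc n) * of_nat (n choose j)"
        by (metis of_nat_mult)
      then show ?thesis by (simp add: frac_eq_eq mult.commute del: of_nat_Suc)
    qed
    then have "complex_of_nat (n choose j) * of_real (bernoulli (n - j)) / of_nat (Suc j) =
      of_real (of_nat (Suc n choose (n - j)) * bernoulli (n - j)) / of_nat (Suc n)" if "j \<le> n" for j
      using that by (metis of_real_mult of_real_of_nat_eq times_divide_eq_left)
    then show ?thesis by (auto simp: F_def intro!: sum.cong simp del: of_nat_Suc)
  qed
  also have "\<dots> = (\<Sum>l<Suc n. of_real (of_nat (Suc n choose l) * bernoulli l) / of_nat (Suc n))"
    by (rule sum.reindex_bij_witness[of _ "\<lambda>l. n - l" "\<lambda>j. n - j"]) auto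
  also have "\<dots> = of_real (\<Sum>l<Suc n. of_nat (Suc n choose l) * bernoulli l) / of_nat (Suc n)"
    by (simp add: sum_divide_distrib del: sum.lessThan_Suc)
  also have "\<dots> = 0"
    using assms by (simp only: bernoulli_recurrence) simp
  finally show ?thesis .
qed

section \<open>Bernoulli polynomials rescaled to the period 2 pi i of the exponential\<close>

definition bern_log :: "nat \<Rightarrow> complex \<Rightarrow> complex" where
  "bern_log n x = (2 * of_real pi * \<i>) ^ n / of_nat (n + 1) * bernpoly (n + 1) (x / (2 * of_real pi * \<i>))"

text \<open>A shift by 2 pi i is a unit shift in the rescaled variable, where
  \<open>bernpoly (n + 1)\<close> changes by \<open>n + 1\<close> times an n-th power. The prefactor
  of \<open>bern_log\<close> cancels both \<open>n + 1\<close> and the scaling.\<close>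

lemma bern_log_shift: "bern_log n (x + 2 * of_real pi * \<i>) - bern_log n x = x ^ n"
proof -
  define p where "p = 2 * complex_of_real pi * \<i>"
  have p: "p \<noteq> 0" by (simp add: p_def)
  have "bern_log n (x + p) - bern_log n x =
      p ^ n / of_nat (n + 1) * (bernpoly (n + 1) (x / p + 1) - bernpoly (n + 1) (x / p))"
    using p by (simp add: bern_log_def p_def[symmetric] add_divide_distrib right_diff_distrib)
  also have "\<dots> = x ^ n"
    unfolding bernpoly_diff using p by (simp add: power_divide del: of_nat_Suc)
  finally show ?thesis by (simp add: p_def)
qed

text \<open>Rescales \<open>bernpoly_integral\<close>. This vanishing later removes the only
  constant term that a small circle could contribute to the finite part.\<close>

lemma bern_log_integral: "(bern_log n has_contour_integral 0) (linepath 0 (2 * of_real pi * \<i>))"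
proof -
  define p where "p = 2 * complex_of_real pi * \<i>"
  have p: "p \<noteq> 0" by (simp add: p_def)
  have bl: "bern_log n x = p ^ n / of_nat (n + 1) * bernpoly (n + 1) (x / p)" for x
    by (simp only: bern_log_def p_def)
  have "((\<lambda>x. bernpoly (n + 1) (of_real x)) has_integral 0) {0..1}"
    using bernpoly_integral[of "n + 1"] unfolding has_contour_integral_linepath
    by (simp add: linepath_def scaleR_conv_of_real)
  from has_integral_mult_right[OF this, of "p ^ n / of_nat (n + 1) * p"]
  have "((\<lambda>x. p ^ n / of_nat (n + 1) * p * bernpoly (n + 1) (of_real x)) has_integral 0) {0..1}"
    by simp
  then have "(bern_log n has_contour_integral 0) (linepath 0 p)"
    unfolding has_contour_integral_linepath
    by (rule has_integral_eq[rotated])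
       (use p in \<open>simp add: bl linepath_def scaleR_conv_of_real mult.commute\<close>)
  then show ?thesis by (simp add: p_def)
qed

text \<open>Yields the weights of the claimed formula: the top coefficient involves B_0 = 1, and for
  \<open>j \<le> n\<close> absorption turns \<open>(n + 1 choose j) / (n + 1)\<close> into
  \<open>(n choose j) / (n - j + 1)\<close>.\<close>

lemma bern_log_expand:
  "bern_log n x = 1 / (2 * of_real pi * \<i> * of_nat (n + 1)) * x ^ (n + 1) +
     (\<Sum>j=0..n. of_nat (n choose j) * (2 * of_real pi * \<i>) ^ (n - j) *
        (of_real (bernoulli (n - j + 1)) / of_nat (n - j + 1)) * x ^ j)"
proof -
  define p where "p = 2 * complex_of_real pi * \<i>"
  have p: "p \<noteq> 0" by (simp add: p_def)
  have b0: "bernoulli 0 = 1" using bernoulli_recurrence[of 1] by simp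
  have "bern_log n x = (\<Sum>j\<le>n + 1. p ^ n / of_nat (n + 1) *
      (of_nat (n + 1 choose j) * of_real (bernoulli (n + 1 - j)) * (x / p) ^ j))"
    by (simp only: bern_log_def bernpoly_def sum_distrib_left p_def)
  also have "\<dots> = p ^ n / of_nat (n + 1) * (x / p) ^ (n + 1) + (\<Sum>j\<le>n. p ^ n / of_nat (n + 1) *
      (of_nat (n + 1 choose j) * of_real (bernoulli (n + 1 - j)) * (x / p) ^ j))"
    by (simp add: b0 del: of_nat_Suc power_Suc binomial_Suc_Suc)
  also have "p ^ n / of_nat (n + 1) * (x / p) ^ (n + 1) = 1 / (p * of_nat (n + 1)) * x ^ (n + 1)"
    using p by (simp add: power_divide field_simps del: of_nat_Suc)
  also have "(\<Sum>j\<le>n. p ^ n / of_nat (n + 1) *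
      (of_nat (n + 1 choose j) * of_real (bernoulli (n + 1 - j)) * (x / p) ^ j)) =
    (\<Sum>j=0..n. of_nat (n choose j) * p ^ (n - j) *
        (of_real (bernoulli (n - j + 1)) / of_nat (n - j + 1)) * x ^ j)"
    unfolding atLeast0AtMost
  proof (intro sum.cong refl)
    fix j assume "j \<in> {..n}"
    then have j: "j \<le> n" by simp
    have "(n - j + 1) * (n + 1 choose j) = (n + 1) * (n choose j)"
      using binomial_absorb_comp[of "n + 1" j] j by (simp add: Suc_diff_le)
    then have "complex_of_nat (n - j + 1) * of_nat (n + 1 choose j) = of_nat (n + 1) * of_nat (n choose j)"
      by (metis of_nat_mult)
    then have e1: "complex_of_nat (n + 1 choose j) / of_nat (n + 1) = of_nat (n choose j) / of_nat (n - j + 1)"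
      by (simp add: frac_eq_eq mult.commute del: of_nat_Suc of_nat_add)
    have e2: "p ^ n * (x / p) ^ j = p ^ (n - j) * x ^ j"
      using p j by (simp add: power_divide power_diff)
    have e3: "n + 1 - j = n - j + 1" using j by simp
    \<comment> \<open>Regroups the product so that the left-hand sides of \<open>e1\<close> and
      \<open>e2\<close> occur as subterms.\<close>
    have e4: "u / v * (w * \<beta> * y) = w / v * \<beta> * (u * y)" for u v w \<beta> y :: complex
      by simp
    show "p ^ n / of_nat (n + 1) *
        (of_nat (n + 1 choose j) * of_real (bernoulli (n + 1 - j)) * (x / p) ^ j) =
      of_nat (n choose j) * p ^ (n - j) * (of_real (bernoulli (n - j + 1)) / of_nat (n - j + 1)) * x ^ j"
      unfolding e4 e3 e1 e2 by simp
  qed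
  finally show ?thesis by (simp only: p_def)
qed

lemma bern_log_poly: obtains c where "bern_log n = (\<lambda>x. \<Sum>j\<le>n + 1. c j * x ^ j)"
proof -
  define p where "p = 2 * complex_of_real pi * \<i>"
  define c where "c = (\<lambda>j. p ^ n / of_nat (n + 1) *
      (of_nat (n + 1 choose j) * of_real (bernoulli (n + 1 - j)) / p ^ j))"
  have "bern_log n x = (\<Sum>j\<le>n + 1. c j * x ^ j)" for x
    unfolding bern_log_def bernpoly_def sum_distrib_left p_def[symmetric] c_def
    by (intro sum.cong refl) (simp add: power_divide del: of_nat_Suc binomial_Suc_Suc)
  then show ?thesis using that by blast
qed

lemma holomorphic_on_bern_log [holomorphic_intros]: "bern_log n holomorphic_on S"
  unfolding bern_log_def bernpoly_def by (intro holomorphic_intros) auto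

section \<open>The contour in logarithmic coordinates\<close>

lemma ln_cut_exp: "0 \<le> Im w \<Longrightarrow> Im w < 2 * pi \<Longrightarrow> ln_cut (exp w) = w"
  by (simp add: ln_cut_def Arg2pi_exp complex_eq_iff)

text \<open>The point \<open>- z\<close> avoids the cut of the principal \<open>Ln\<close>, and the
  half turn costs i pi. In this form \<open>ln_cut\<close> inherits continuity and derivatives from
  \<open>Ln\<close> off its own cut.\<close>

lemma ln_cut_eq_Ln_minus:
  assumes "z \<notin> \<real>\<^sub>\<ge>\<^sub>0"
  shows "ln_cut z = Ln (- z) + \<i> * of_real pi"
proof -
  have "- z \<notin> \<real>\<^sub>\<le>\<^sub>0" using assms by (simp add: complex_nonneg_Reals_iff complex_nonpos_Reals_iff)
  moreover have nz: "z \<noteq> 0" using assms by auto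
  ultimately have "Im (Ln (- z)) < pi" "- pi < Im (Ln (- z))"
    using Im_Ln_less_pi mpi_less_Im_Ln[of "- z"] by auto
  then have "ln_cut (exp (Ln (- z) + \<i> * of_real pi)) = Ln (- z) + \<i> * of_real pi"
    by (intro ln_cut_exp) auto
  moreover have "exp (Ln (- z) + \<i> * of_real pi) = z"
    using nz by (simp add: exp_add)
  ultimately show ?thesis by simp
qed

text \<open>\<open>Ln\<close> is continuous across the positive axis, so this lemma and its lower
  companion give the one-sided limits of \<open>ln_cut\<close> there, which differ by 2 pi
  i.\<close>

lemma ln_cut_upper: "Im z > 0 \<Longrightarrow> ln_cut z = Ln z"
  using ln_cut_exp[of "Ln z"] Im_Ln_pos_lt_imp[of z] by (cases "z = 0") auto

lemma ln_cut_lower: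
  assumes "Im z < 0"
  shows "ln_cut z = Ln z + 2 * of_real pi * \<i>"
proof -
  have nz: "z \<noteq> 0" using assms by auto
  then have "\<not> 0 \<le> Im (Ln z)" "- pi < Im (Ln z)"
    using assms Im_Ln_pos_le[of z] mpi_less_Im_Ln[of z] Im_Ln_le_pi[of z] by auto
  then have "ln_cut (exp (Ln z + 2 * of_real pi * \<i>)) = Ln z + 2 * of_real pi * \<i>"
    by (intro ln_cut_exp) auto
  then show ?thesis using nz by (simp add: exp_add)
qed

lemma exp_ln_cut: "z \<noteq> 0 \<Longrightarrow> exp (ln_cut z) = z"
  by (metis Arg2pi_eq exp_add exp_of_real exp_ln ln_cut_def zero_less_norm_iff)

text \<open>
  At both endpoints of the contour \<open>ln_cut\<close> takes its upper value \<open>ln a\<close>; the lift instead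
  takes the one-sided limits, which makes it continuous on \<open>{0..1}\<close>.
\<close>

definition log_lift :: "real \<Rightarrow> (real \<Rightarrow> complex) \<Rightarrow> real \<Rightarrow> complex" where
  "log_lift a g t =
     (if t \<le> 0 then of_real (ln a) else if t \<ge> 1 then of_real (ln a) + 2 * of_real pi * \<i>
      else ln_cut (g t))"

context
  fixes a :: real and k :: "complex \<Rightarrow> complex" and g :: "real \<Rightarrow> complex"
  assumes a: "0 < a" and cc: "cut_contour k a g"
begin

lemma cut_contour_valid_path: "valid_path g" and cut_contour_start: "g 0 = of_real a" and cut_contour_finish: "g 1 = of_real a"
  and cut_contour_off_cut: "t \<in> {0<..<1} \<Longrightarrow> g t \<notin> \<real>\<^sub>\<ge>\<^sub>0"
  and cut_contour_upper: "\<forall>\<^sub>F t in at_right 0. Im (g t) > 0"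
  and cut_contour_lower: "\<forall>\<^sub>F t in at_left 1. Im (g t) < 0"
  using cc by (auto simp: cut_contour_def pathstart_def pathfinish_def)

lemma exp_log_lift:
  assumes "t \<in> {0..1}"
  shows "exp (log_lift a g t) = g t"
proof (cases "t = 0 \<or> t = 1")
  case True
  then show ?thesis using cut_contour_start cut_contour_finish a by (auto simp: log_lift_def exp_add exp_of_real)
next
  case False
  then have "g t \<notin> \<real>\<^sub>\<ge>\<^sub>0" using assms cut_contour_off_cut by auto
  then have "g t \<noteq> 0" by auto
  then show ?thesis using False assms by (simp add: log_lift_def exp_ln_cut)
qed

lemma log_lift_strip:
  assumes "t \<in> {0<..<1}"
  shows "0 < Im (log_lift a g t)" "Im (log_lift a g t) < 2 * pi"
proof -
  have "Arg2pi (g t) \<noteq> 0"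
    using cut_contour_off_cut[OF assms] by (auto simp: Arg2pi_eq_0 complex_nonneg_Reals_iff complex_is_Real_iff)
  then show "0 < Im (log_lift a g t)" "Im (log_lift a g t) < 2 * pi"
    using assms Arg2pi_ge_0[of "g t"] Arg2pi_lt_2pi[of "g t"] by (auto simp: log_lift_def ln_cut_def)
qed

text \<open>Locally the lift is a continuous branch of the logarithm: \<open>Ln\<close> near 0,
  \<open>Ln\<close> plus 2 pi i near 1, and the rotated \<open>Ln\<close> in between. The conditions
  on the sign of \<open>Im (g t)\<close> in \<open>cut_contour\<close> select the branch at the two
  ends.\<close>

lemma continuous_on_log_lift: "continuous_on {0..1} (log_lift a g)"
proof -
  have cg: "continuous_on {0..1} g" using cut_contour_valid_path valid_path_imp_path path_def by blast
  have "(log_lift a g \<longlongrightarrow> log_lift a g t) (at t within {0..1})" if t: "t \<in> {0..1}" for t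
  proof -
    have gt: "(g \<longlongrightarrow> g t) (at t within {0..1})" using cg t by (auto simp: continuous_on)
    have pos: "complex_of_real a \<notin> \<real>\<^sub>\<le>\<^sub>0" using a by simp
    consider "t = 0" | "t = 1" | "t \<in> {0<..<1}" using t by force
    then show ?thesis
    proof cases
      case 1
      have at: "at t within {0..1} = at_right 0" using 1 at_within_Icc_at_right[of 0 "1::real"] by simp
      have "((\<lambda>s. Ln (g s)) \<longlongrightarrow> Ln (g t)) (at_right 0)"
        using gt unfolding at by (intro tendsto_intros) (use 1 cut_contour_start pos in auto)
      then have "((\<lambda>s. Ln (g s)) \<longlongrightarrow> log_lift a g t) (at_right 0)"
        using a by (simp add: 1 cut_contour_start log_lift_def Ln_of_real)
      moreover have "\<forall>\<^sub>F s in at_right 0. Ln (g s) = log_lift a g s"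
        using cut_contour_upper eventually_at_right_real[of 0 "1::real", simplified]
        by eventually_elim (simp add: log_lift_def ln_cut_upper)
      ultimately show ?thesis unfolding at by (rule Lim_transform_eventually)
    next
      case 2
      have at: "at t within {0..1} = at_left 1" using 2 at_within_Icc_at_left[of 0 "1::real"] by simp
      have "((\<lambda>s. Ln (g s) + 2 * of_real pi * \<i>) \<longlongrightarrow> Ln (g t) + 2 * of_real pi * \<i>) (at_left 1)"
        using gt unfolding at by (intro tendsto_intros) (use 2 cut_contour_finish pos in auto)
      then have "((\<lambda>s. Ln (g s) + 2 * of_real pi * \<i>) \<longlongrightarrow> log_lift a g t) (at_left 1)"
        using a by (simp add: 2 cut_contour_finish log_lift_def Ln_of_real)
      moreover have "\<forall>\<^sub>F s in at_left 1. Ln (g s) + 2 * of_real pi * \<i> = log_lift a g s"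
        using cut_contour_lower eventually_at_left_real[of 0 "1::real", simplified]
        by eventually_elim (simp add: log_lift_def ln_cut_lower)
      ultimately show ?thesis unfolding at by (rule Lim_transform_eventually)
    next
      case 3
      have "- g t \<notin> \<real>\<^sub>\<le>\<^sub>0"
        using cut_contour_off_cut[OF 3] by (simp add: complex_nonneg_Reals_iff complex_nonpos_Reals_iff)
      then have "((\<lambda>s. Ln (- g s) + \<i> * of_real pi) \<longlongrightarrow> Ln (- g t) + \<i> * of_real pi) (at t within {0..1})"
        using gt by (intro tendsto_intros) auto
      then have "((\<lambda>s. Ln (- g s) + \<i> * of_real pi) \<longlongrightarrow> log_lift a g t) (at t within {0..1})"
        using 3 by (simp add: log_lift_def ln_cut_eq_Ln_minus[OF cut_contour_off_cut[OF 3]])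
      moreover have "\<forall>\<^sub>F s in at t within {0..1}. s \<in> {0<..<1}"
        using 3 by (intro filter_leD[OF at_le[OF subset_UNIV] eventually_at_in_open']) auto
      then have "\<forall>\<^sub>F s in at t within {0..1}. Ln (- g s) + \<i> * of_real pi = log_lift a g s"
        by eventually_elim (simp add: log_lift_def ln_cut_eq_Ln_minus[OF cut_contour_off_cut])
      ultimately show ?thesis by (rule Lim_transform_eventually)
    qed
  qed
  then show ?thesis by (simp add: continuous_on)
qed

lemma log_lift_vector_derivative:
  assumes "t \<in> {0<..<1}" "(g has_vector_derivative D) (at t)"
  shows "(log_lift a g has_vector_derivative D / g t) (at t)"
proof -
  have "- g t \<notin> \<real>\<^sub>\<le>\<^sub>0"
    using cut_contour_off_cut[OF assms(1)] by (simp add: complex_nonneg_Reals_iff complex_nonpos_Reals_iff)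
  then have "((\<lambda>z. Ln (- z) + \<i> * of_real pi) has_field_derivative 1 / g t) (at (g t))"
    by (auto intro!: derivative_eq_intros simp: inverse_eq_divide)
  from field_vector_diff_chain_at[OF assms(2) this]
  have "((\<lambda>s. Ln (- g s) + \<i> * of_real pi) has_vector_derivative D / g t) (at t)"
    by (simp add: o_def)
  then show ?thesis
    by (rule has_vector_derivative_transform_within_open[of _ _ _ "{0<..<1}"])
       (use assms(1) in \<open>auto simp: log_lift_def ln_cut_eq_Ln_minus cut_contour_off_cut\<close>)
qed

lemma valid_path_log_lift: "valid_path (log_lift a g)"
proof -
  have nz: "g t \<noteq> 0" if "t \<in> {0..1}" for t
    using exp_log_lift[OF that] by (metis exp_not_eq_zero)
  have cg: "continuous_on {0..1} g" using cut_contour_valid_path valid_path_imp_path path_def by blast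
  obtain S D where S: "finite S" "\<And>t. t \<in> {0..1} - S \<Longrightarrow> (g has_vector_derivative D t) (at t)"
      "continuous_on ({0..1} - S) D"
    using cut_contour_valid_path unfolding valid_path_def piecewise_C1_differentiable_on_def C1_differentiable_on_def
    by metis
  \<comment> \<open>The endpoints join the exceptional set because \<open>log_lift\<close> is
    constant outside \<open>{0..1}\<close>, so a two-sided derivative may fail to exist
    there.\<close>
  have "log_lift a g C1_differentiable_on ({0..1} - ({0, 1} \<union> S))"
    unfolding C1_differentiable_on_def
  proof (intro exI[of _ "\<lambda>t. D t / g t"] conjI ballI)
    show "continuous_on ({0..1} - ({0, 1} \<union> S)) (\<lambda>t. D t / g t)"
      by (intro continuous_intros continuous_on_subset[OF S(3)] continuous_on_subset[OF cg]) (use nz in auto)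
  qed (use S(2) in \<open>auto intro!: log_lift_vector_derivative\<close>)
  then show ?thesis
    unfolding valid_path_def piecewise_C1_differentiable_on_def
    using continuous_on_log_lift S(1) by (meson finite.intros finite_UnI)
qed

text \<open>Substitution \<open>z = exp w\<close>: the integrands in the parameter agree outside a
  finite set, so no regularity of \<open>F\<close> enters. Giving \<open>F\<close> a separate
  argument for the logarithm lets \<open>w\<close> itself replace \<open>ln_cut z\<close>.\<close>

lemma has_contour_integral_log_lift:
  "((\<lambda>z. F z (ln_cut z)) has_contour_integral I) g \<longleftrightarrow>
   ((\<lambda>w. F (exp w) w * exp w) has_contour_integral I) (log_lift a g)"
proof -
  obtain S D where S: "finite S" "\<And>t. t \<in> {0..1} - S \<Longrightarrow> (g has_vector_derivative D t) (at t)"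
    using cut_contour_valid_path unfolding valid_path_def piecewise_C1_differentiable_on_def C1_differentiable_on_def
    by metis
  show ?thesis
    unfolding has_contour_integral
  proof (rule has_integral_spike_finite_eq[of "{0, 1} \<union> S"])
    fix t :: real assume t: "t \<in> {0..1} - ({0, 1} \<union> S)"
    then have t': "t \<in> {0<..<1}" by auto
    have D: "(g has_vector_derivative D t) (at t)" using S(2) t by simp
    have "vector_derivative (log_lift a g) (at t) = D t / g t"
      using log_lift_vector_derivative[OF t' D] by (rule vector_derivative_at)
    moreover have "exp (log_lift a g t) = g t" using exp_log_lift t by auto
    moreover have "g t \<noteq> 0" using calculation(2) by (metis exp_not_eq_zero)
    moreover have "log_lift a g t = ln_cut (g t)" using t' by (simp add: log_lift_def)
    ultimately show "F (exp (log_lift a g t)) (log_lift a g t) * exp (log_lift a g t) *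
        vector_derivative (log_lift a g) (at t) = F (g t) (ln_cut (g t)) * vector_derivative g (at t)"
      using vector_derivative_at[OF D] by simp
  qed (use S in auto)
qed

end

section \<open>The lifted contour closed up to a loop\<close>

definition keyhole_lift :: "real \<Rightarrow> (real \<Rightarrow> complex) \<Rightarrow> real \<Rightarrow> real \<Rightarrow> complex" where
  "keyhole_lift a g x =
     log_lift a g +++ linepath (of_real (ln a) + 2 * of_real pi * \<i>) (of_real x + 2 * of_real pi * \<i>) +++
     linepath (of_real x + 2 * of_real pi * \<i>) (of_real x) +++ linepath (of_real x) (of_real (ln a))"

lemma open_analytic_points: "open {z. k analytic_on {z}}"
proof (subst open_subopen, safe)
  fix z assume "k analytic_on {z}"
  then obtain T where T: "open T" "z \<in> T" "k holomorphic_on T"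
    by (auto simp: analytic_at)
  then have "T \<subseteq> {z. k analytic_on {z}}" by (auto simp: analytic_at)
  with T show "\<exists>T. open T \<and> z \<in> T \<and> T \<subseteq> {z. k analytic_on {z}}" by blast
qed

text \<open>
  The boundary points removed here are the logarithms of the real numbers beyond \<open>a\<close>.  The strip
  stays convex, so a loop inside it does not wind around them.
\<close>

lemma convex_cut_strip:
  "convex {z. 0 \<le> Im z \<and> Im z \<le> h \<and> (Im z = 0 \<or> Im z = h \<longrightarrow> Re z \<le> r)}"
proof -
  have "0 \<le> Im z \<and> Im z \<le> h \<and> (Im z = 0 \<or> Im z = h \<longrightarrow> Re z \<le> r)"
    if x: "0 \<le> Im x \<and> Im x \<le> h \<and> (Im x = 0 \<or> Im x = h \<longrightarrow> Re x \<le> r)"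
      and y: "0 \<le> Im y \<and> Im y \<le> h \<and> (Im y = 0 \<or> Im y = h \<longrightarrow> Re y \<le> r)"
      and z: "z \<in> open_segment x y" for x y z
  proof -
    obtain u where u: "0 < u" "u < 1" "z = (1 - u) *\<^sub>R x + u *\<^sub>R y"
      using z by (auto simp: in_segment)
    have Imz: "Im z = (1 - u) * Im x + u * Im y" and Rez: "Re z = (1 - u) * Re x + u * Re y"
      using u by auto
    have nn: "0 \<le> (1 - u) * Im x" "0 \<le> u * Im y" "0 \<le> (1 - u) * (h - Im x)" "0 \<le> u * (h - Im y)"
      using x y u by auto
    have hz: "h - Im z = (1 - u) * (h - Im x) + u * (h - Im y)"
      by (simp add: Imz algebra_simps)
    have "Re z \<le> r" if "Im z = 0 \<or> Im z = h"
    proof -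
      have "(1 - u) * Im x = 0 \<and> u * Im y = 0 \<or> (1 - u) * (h - Im x) = 0 \<and> u * (h - Im y) = 0"
        using that nn Imz hz by linarith
      then have "Re x \<le> r" "Re y \<le> r" using x y u by auto
      then have "(1 - u) * Re x + u * Re y \<le> (1 - u) * r + u * r"
        using u by (intro add_mono mult_left_mono) auto
      then show ?thesis by (simp add: Rez algebra_simps)
    qed
    then show ?thesis using Imz hz nn by linarith
  qed
  then show ?thesis unfolding convex_contains_open_segment by blast
qed

lemma exp_plus_2pii: "exp (w + 2 * of_real pi * \<i>) = exp w"
  by (simp add: exp_add)

text \<open>By periodicity of \<open>exp\<close>, the upper horizontal side is mapped onto the lower
  one traversed backwards. Their winding numbers therefore cancel.\<close>

lemma reversepath_exp_line:
  "exp \<circ> linepath (u + 2 * of_real pi * \<i>) (v + 2 * of_real pi * \<i>) = reversepath (exp \<circ> linepath v u)"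
proof
  fix t
  have "linepath (u + 2 * of_real pi * \<i>) (v + 2 * of_real pi * \<i>) t = linepath v u (1 - t) + 2 * of_real pi * \<i>"
    by (simp add: linepath_def algebra_simps)
  then show "(exp \<circ> linepath (u + 2 * of_real pi * \<i>) (v + 2 * of_real pi * \<i>)) t = reversepath (exp \<circ> linepath v u) t"
    by (simp only: o_def exp_plus_2pii reversepath_def)
qed

section \<open>Winding numbers of the closed path and Cauchy's theorem\<close>

context
  fixes a \<epsilon> :: real and k :: "complex \<Rightarrow> complex" and g :: "real \<Rightarrow> complex"
  assumes \<epsilon>: "0 < \<epsilon>" "\<epsilon> \<le> a" and cc: "cut_contour k a g"
    and k_seg: "k analytic_on (complex_of_real ` {0..a})" and k_ball: "k analytic_on cball 0 \<epsilon>"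
begin

private abbreviation (input) "U \<equiv> {z. k analytic_on {z}}"
private abbreviation (input) "A \<equiv> complex_of_real (ln a)"
private abbreviation (input) "X \<equiv> complex_of_real (ln \<epsilon>)"
private abbreviation (input) "P \<equiv> 2 * complex_of_real pi * \<i>"

private lemma a_pos: "0 < a" using \<epsilon> by simp

private lemma log_lift_ends: "pathstart (log_lift a g) = A" "pathfinish (log_lift a g) = A + P"
  by (auto simp: log_lift_def pathstart_def pathfinish_def)

lemma keyhole_lift_valid: "valid_path (keyhole_lift a g (ln \<epsilon>))"
  and keyhole_lift_loop: "pathfinish (keyhole_lift a g (ln \<epsilon>)) = pathstart (keyhole_lift a g (ln \<epsilon>))"
  unfolding keyhole_lift_def
  using valid_path_log_lift[OF a_pos cc] by (simp_all add: log_lift_ends valid_path_join)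

lemma keyhole_lift_image:
  "path_image (keyhole_lift a g (ln \<epsilon>)) = path_image (log_lift a g) \<union> closed_segment (A + P) (X + P) \<union>
     closed_segment (X + P) X \<union> closed_segment X A"
  unfolding keyhole_lift_def by (simp add: path_image_join log_lift_ends Un_assoc)

private lemma log_lift_image_exp: "exp ` path_image (log_lift a g) = path_image g"
  unfolding path_image_def image_image by (rule image_cong) (simp_all add: exp_log_lift[OF a_pos cc])

private lemma analytic_points:
  assumes "k analytic_on T"
  shows "T \<subseteq> U"
  using assms by (auto intro: analytic_on_subset)

private lemma seg_exp: "exp ` closed_segment X A \<subseteq> complex_of_real ` {0..a}"
proof
  fix z assume "z \<in> exp ` closed_segment X A"
  then obtain w where w: "z = exp w" "Im w = 0" "Re w \<in> closed_segment (ln \<epsilon>) (ln a)"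
    by (auto simp: closed_segment_same_Im)
  have "Re w \<le> ln a" using w(3) \<epsilon> by (auto simp: closed_segment_eq_real_ivl split: if_splits)
  then have "exp (Re w) \<le> a" using a_pos by (metis exp_le_cancel_iff exp_ln)
  moreover have "w = of_real (Re w)" using w(2) by (simp add: complex_eq_iff)
  ultimately show "z \<in> complex_of_real ` {0..a}"
    using w(1) by (metis atLeastAtMost_iff exp_ge_zero exp_of_real imageI)
qed

private lemma circle_exp: "exp ` closed_segment (X + P) X \<subseteq> cball 0 \<epsilon>"
proof
  fix z assume "z \<in> exp ` closed_segment (X + P) X"
  then obtain w where w: "z = exp w" "w \<in> closed_segment (X + P) X" by auto
  have "Re w = ln \<epsilon>" using w(2) by (simp add: closed_segment_same_Re)
  then show "z \<in> cball 0 \<epsilon>" using w(1) \<epsilon> by simp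
qed

private lemma shifted_seg_exp: "exp ` closed_segment (A + P) (X + P) \<subseteq> exp ` closed_segment X A"
proof
  fix z assume "z \<in> exp ` closed_segment (A + P) (X + P)"
  then obtain w where w: "z = exp w" "w \<in> closed_segment (A + P) (X + P)" by auto
  then have "w \<in> (\<lambda>w. P + w) ` closed_segment A X"
    using closed_segment_translation[of P A X] by (simp add: add.commute)
  then obtain v where v: "w = v + P" "v \<in> closed_segment X A"
    by (auto simp: closed_segment_commute)
  then show "z \<in> exp ` closed_segment X A" using w by (metis exp_plus_2pii imageI)
qed

lemma keyhole_lift_exp: "exp ` path_image (keyhole_lift a g (ln \<epsilon>)) \<subseteq> U"
proof -
  have "k analytic_on path_image g" using cc by (simp add: cut_contour_def)
  then have "exp ` path_image (log_lift a g) \<subseteq> U"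
    unfolding log_lift_image_exp by (rule analytic_points)
  moreover have "exp ` closed_segment X A \<subseteq> U"
    using seg_exp analytic_points[OF k_seg] by blast
  moreover have "exp ` closed_segment (X + P) X \<subseteq> U"
    using circle_exp analytic_points[OF k_ball] by blast
  ultimately show ?thesis
    unfolding keyhole_lift_image image_Un using shifted_seg_exp by blast
qed

text \<open>The lift meets the boundary lines of the strip only at its two ends, and the straight
  sides join four corners that lie in the convex set of \<open>convex_cut_strip\<close>.\<close>

lemma keyhole_lift_strip:
  "path_image (keyhole_lift a g (ln \<epsilon>)) \<subseteq>
     {z. 0 \<le> Im z \<and> Im z \<le> 2 * pi \<and> (Im z = 0 \<or> Im z = 2 * pi \<longrightarrow> Re z \<le> ln a)}"
    (is "_ \<subseteq> ?S")
proof -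
  have "log_lift a g t \<in> {z. 0 \<le> Im z \<and> Im z \<le> 2 * pi \<and> (Im z = 0 \<or> Im z = 2 * pi \<longrightarrow> Re z \<le> ln a)}"
    if "t \<in> {0..1}" for t
  proof (cases "t = 0 \<or> t = 1")
    case True
    then have "log_lift a g t = A \<or> log_lift a g t = A + P" by (auto simp: log_lift_def)
    then show ?thesis by auto
  next
    case False
    then have "t \<in> {0<..<1}" using that by auto
    from log_lift_strip[OF a_pos cc this] show ?thesis by simp
  qed
  then have "path_image (log_lift a g) \<subseteq> ?S" by (auto simp: path_image_def)
  moreover have "A \<in> ?S" "X \<in> ?S" "A + P \<in> ?S" "X + P \<in> ?S" using \<epsilon> by simp_all
  ultimately show ?thesis
    unfolding keyhole_lift_image by (intro Un_least closed_segment_subset convex_cut_strip)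
qed

text \<open>The images of the horizontal sides cancel, and the small circle stays in a disc where
  \<open>k\<close> is analytic, hence does not wind around \<open>z\<close>. What remains is the
  winding number of \<open>g\<close>, which is 0 because \<open>k\<close> is analytic at all
  enclosed points.\<close>

lemma winding_number_exp_keyhole:
  assumes z: "z \<notin> U"
  shows "winding_number (exp \<circ> keyhole_lift a g (ln \<epsilon>)) z = 0"
proof -
  have v: "path (log_lift a g)" using valid_path_log_lift[OF a_pos cc] by (rule valid_path_imp_path)
  have cexp: "path (exp \<circ> p)" if "path p" for p :: "real \<Rightarrow> complex"
    using that by (intro path_continuous_image continuous_intros)
  have notin: "z \<notin> exp ` path_image (log_lift a g)" "z \<notin> exp ` closed_segment (A + P) (X + P)"
    "z \<notin> exp ` closed_segment (X + P) X" "z \<notin> exp ` closed_segment X A"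
    using keyhole_lift_exp z unfolding keyhole_lift_image image_Un by blast+
  have "winding_number (exp \<circ> keyhole_lift a g (ln \<epsilon>)) z =
     winding_number (exp \<circ> log_lift a g) z + (winding_number (exp \<circ> linepath (A + P) (X + P)) z +
     (winding_number (exp \<circ> linepath (X + P) X) z + winding_number (exp \<circ> linepath X A) z))"
    unfolding keyhole_lift_def path_compose_join
    using notin v
    by (subst winding_number_join; (simp add: path_image_compose path_image_join cexp pathstart_compose pathfinish_compose log_lift_ends)?)+
  also have "winding_number (exp \<circ> linepath (A + P) (X + P)) z = - winding_number (exp \<circ> linepath X A) z"
    unfolding reversepath_exp_line
    using notin by (intro winding_number_reversepath cexp) (auto simp: path_image_compose)
  also have "winding_number (exp \<circ> linepath (X + P) X) z = 0"
  proof (rule winding_number_zero_outside[of _ "cball 0 \<epsilon>"])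
    show "z \<notin> cball 0 \<epsilon>" using z analytic_points[OF k_ball] by blast
    show "path_image (exp \<circ> linepath (X + P) X) \<subseteq> cball 0 \<epsilon>"
      using circle_exp by (simp add: path_image_compose)
  qed (auto simp: pathstart_compose pathfinish_compose exp_plus_2pii intro!: cexp)
  also have "winding_number (exp \<circ> log_lift a g) z = winding_number g z"
    by (rule winding_number_cong) (use exp_log_lift[OF a_pos cc] in auto)
  also have "\<dots> = 0"
  proof -
    have "z \<notin> path_image g" using notin(1) by (simp add: log_lift_image_exp)
    moreover have "k analytic_on {w. w \<notin> path_image g \<and> winding_number g w \<noteq> 0}"
      using cc by (simp add: cut_contour_def)
    ultimately show ?thesis using z analytic_points by blast
  qed
  finally show ?thesis by (simp add: o_def)
qed

text \<open>On the boundary lines of the strip, \<open>exp w\<close> not being in the segment forces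
  \<open>w\<close> beyond \<open>ln a\<close>, outside the convex set that holds the path. In the
  open strip, turns around \<open>w\<close> are the same as turns of the image around
  \<open>exp w\<close>, which were just shown to be 0.\<close>

lemma winding_number_keyhole_lift:
  assumes w: "exp w \<notin> U"
  shows "winding_number (keyhole_lift a g (ln \<epsilon>)) w = 0"
proof (cases "0 < Im w \<and> Im w < 2 * pi")
  case False
  have "w \<notin> {z. 0 \<le> Im z \<and> Im z \<le> 2 * pi \<and> (Im z = 0 \<or> Im z = 2 * pi \<longrightarrow> Re z \<le> ln a)}"
  proof
    assume "w \<in> {z. 0 \<le> Im z \<and> Im z \<le> 2 * pi \<and> (Im z = 0 \<or> Im z = 2 * pi \<longrightarrow> Re z \<le> ln a)}"
    then have Im: "Im w = 0 \<or> Im w = 2 * pi" and Re: "Re w \<le> ln a" using False by auto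
    have "exp w = of_real (exp (Re w))"
      using Im by (auto simp: exp_eq_polar cis_conv_exp[symmetric] complex_eq_iff)
    moreover have "exp (Re w) \<le> a" using Re a_pos by (metis exp_le_cancel_iff exp_ln)
    ultimately have "exp w \<in> complex_of_real ` {0..a}" by (auto intro!: image_eqI)
    then show False using analytic_points[OF k_seg] w by blast
  qed
  then show ?thesis
    using keyhole_lift_strip keyhole_lift_valid keyhole_lift_loop
    by (intro winding_number_zero_outside[OF _ convex_cut_strip]) (auto simp: valid_path_imp_path)
next
  case True
  \<comment> \<open>Since \<open>w\<close> is in the open strip, \<open>S\<close> contains the whole
    path, yet it excludes every other logarithm \<open>w + 2 pi i m\<close> of
    \<open>exp w\<close>.\<close>
  define S where "S = {z. Im w - 2 * pi < Im z \<and> Im z < Im w + 2 * pi}"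
  define \<Gamma> where "\<Gamma> = keyhole_lift a g (ln \<epsilon>)"
  have eq: "S = {z. Im z > Im w - 2 * pi} \<inter> {z. Im z < Im w + 2 * pi}" by (auto simp: S_def)
  have openS: "open S" unfolding eq by (intro open_Int open_halfspace_Im_gt open_halfspace_Im_lt)
  have convS: "convex S" unfolding eq by (intro convex_Int convex_halfspace_Im_gt convex_halfspace_Im_lt)
  have wS: "w \<in> S" using pi_gt_zero by (auto simp: S_def)
  have inj: "z = w" if "z \<in> S" "exp z = exp w" for z
  proof (rule exp_complex_eqI)
    show "\<bar>Im z - Im w\<bar> < 2 * pi" using that(1) by (simp add: S_def abs_less_iff)
  qed (rule that(2))
  have \<Gamma>: "valid_path \<Gamma>" "pathfinish \<Gamma> = pathstart \<Gamma>" "path_image \<Gamma> \<subseteq> S - {w}"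
    using keyhole_lift_valid keyhole_lift_loop keyhole_lift_strip keyhole_lift_exp w True
    by (auto simp: \<Gamma>_def S_def)
  \<comment> \<open>Inside \<open>S\<close> the only pole of \<open>exp z / (exp z - exp w)\<close> is \<open>w\<close>, with residue 1, and its integral
    over \<open>\<Gamma>\<close> counts the turns of \<open>exp \<circ> \<Gamma>\<close> around \<open>exp w\<close>.\<close>
  have "contour_integral \<Gamma> (\<lambda>z. exp z / (exp z - exp w)) =
      2 * pi * \<i> * (\<Sum>p\<in>{w}. winding_number \<Gamma> p * residue (\<lambda>z. exp z / (exp z - exp w)) p)"
  proof (rule Residue_theorem[OF openS])
    show "(\<lambda>z. exp z / (exp z - exp w)) holomorphic_on S - {w}"
      using inj by (intro holomorphic_intros) auto
    show "\<forall>z. z \<notin> S \<longrightarrow> winding_number \<Gamma> z = 0"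
      using \<Gamma> convS by (auto intro: winding_number_zero_outside[of _ S] valid_path_imp_path)
  qed (use \<Gamma> convS in \<open>auto simp: convex_connected\<close>)
  moreover have "residue (\<lambda>z. exp z / (exp z - exp w)) w = exp w / exp w"
    by (rule residue_simple_pole_deriv[of _ S])
       (use openS convS wS in \<open>auto intro!: holomorphic_intros derivative_eq_intros convex_connected\<close>)
  moreover have "contour_integral \<Gamma> (\<lambda>z. exp z / (exp z - exp w)) =
      contour_integral (exp \<circ> \<Gamma>) (\<lambda>z. 1 / (z - exp w))"
    by (subst contour_integral_comp_analyticW[of exp UNIV])
       (use \<Gamma> in \<open>auto intro!: analytic_intros simp: DERIV_imp_deriv[OF DERIV_exp]\<close>)
  moreover have "contour_integral (exp \<circ> \<Gamma>) (\<lambda>z. 1 / (z - exp w)) = 0"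
  proof -
    have "exp w \<notin> path_image (exp \<circ> \<Gamma>)"
      using keyhole_lift_exp w by (auto simp: path_image_compose \<Gamma>_def)
    moreover have "valid_path (exp \<circ> \<Gamma>)"
      using \<Gamma> by (intro valid_path_compose_analytic[of _ _ UNIV]) (auto intro!: analytic_intros)
    ultimately have "winding_number (exp \<circ> \<Gamma>) (exp w) =
        1 / (2 * pi * \<i>) * contour_integral (exp \<circ> \<Gamma>) (\<lambda>z. 1 / (z - exp w))"
      by (intro winding_number_valid_path)
    then show ?thesis using winding_number_exp_keyhole[OF w] by (simp add: \<Gamma>_def)
  qed
  ultimately show ?thesis by (simp add: \<Gamma>_def)
qed

text \<open>Cauchy's theorem on the closed path. As \<open>k (exp w)\<close> has period 2 pi i, the
  horizontal sides combine into the difference of \<open>G\<close>. A general entire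
  \<open>G\<close> covers both the rescaled Bernoulli polynomial and the single powers of the
  logarithm.\<close>

lemma contour_integral_log_lift:
  assumes G: "G holomorphic_on UNIV"
  shows "contour_integral (log_lift a g) (\<lambda>w. k (exp w) * G w) =
     contour_integral (linepath X A) (\<lambda>w. k (exp w) * (G (w + P) - G w)) +
     contour_integral (linepath X (X + P)) (\<lambda>w. k (exp w) * G w)"
    and "(\<lambda>w. k (exp w) * G w) contour_integrable_on log_lift a g"
proof -
  define f where "f = (\<lambda>w. k (exp w) * G w)"
  define V where "V = exp -` U"
  have openV: "open V"
    unfolding V_def by (intro open_vimage open_analytic_points continuous_intros)
  have "k holomorphic_on U"
    by (rule analytic_imp_holomorphic) (subst analytic_on_analytic_at, auto)
  then have "(k \<circ> exp) holomorphic_on V"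
    by (intro holomorphic_on_compose_gen[of exp V k U] holomorphic_intros) (auto simp: V_def)
  then have f: "f holomorphic_on V"
    unfolding f_def by (intro holomorphic_intros holomorphic_on_subset[OF G]) (auto simp: o_def)
  have im: "path_image (log_lift a g) \<subseteq> V" "closed_segment (A + P) (X + P) \<subseteq> V"
     "closed_segment (X + P) X \<subseteq> V" "closed_segment X A \<subseteq> V"
    using keyhole_lift_exp unfolding keyhole_lift_image V_def by auto
  have fi: "f contour_integrable_on p" if "valid_path p" "path_image p \<subseteq> V" for p
    using contour_integrable_holomorphic_simple[OF f openV that] .
  show "(\<lambda>w. k (exp w) * G w) contour_integrable_on log_lift a g"
    using fi[of "log_lift a g"] valid_path_log_lift[OF a_pos cc] im by (simp add: f_def)
  have "contour_integral (keyhole_lift a g (ln \<epsilon>)) f = 0"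
  proof (rule contour_integral_unique, rule Cauchy_theorem_global[OF openV f])
    show "path_image (keyhole_lift a g (ln \<epsilon>)) \<subseteq> V"
      using keyhole_lift_exp by (auto simp: V_def)
    show "winding_number (keyhole_lift a g (ln \<epsilon>)) w = 0" if "w \<notin> V" for w
      using that winding_number_keyhole_lift by (simp add: V_def)
  qed (use keyhole_lift_valid keyhole_lift_loop in auto)
  also have "contour_integral (keyhole_lift a g (ln \<epsilon>)) f =
     contour_integral (log_lift a g) f + (contour_integral (linepath (A + P) (X + P)) f +
     (contour_integral (linepath (X + P) X) f + contour_integral (linepath X A) f))"
    unfolding keyhole_lift_def
    using fi im valid_path_log_lift[OF a_pos cc]
    by (simp add: log_lift_ends contour_integrable_joinI)
  finally have sum0: "contour_integral (log_lift a g) f + (contour_integral (linepath (A + P) (X + P)) f +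
     (contour_integral (linepath (X + P) X) f + contour_integral (linepath X A) f)) = 0" .
  have cf: "continuous_on V f" using f by (rule holomorphic_on_imp_continuous_on)
  have rev: "contour_integral (linepath (X + P) X) f = - contour_integral (linepath X (X + P)) f"
    by (rule contour_integral_reverse_linepath) (use im cf continuous_on_subset closed_segment_commute in metis)
  have rev2: "contour_integral (linepath (A + P) (X + P)) f = - contour_integral (linepath (X + P) (A + P)) f"
    by (rule contour_integral_reverse_linepath) (use im cf continuous_on_subset closed_segment_commute in metis)
  have tr: "(+) P \<circ> linepath X A = linepath (X + P) (A + P)"
    by (rule ext) (simp add: linepath_def algebra_simps)
  have fi4: "f contour_integrable_on linepath X A" using fi im by simp
  have "f contour_integrable_on linepath (X + P) (A + P)"
    using fi im by (simp add: closed_segment_commute)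
  then have fi1: "(\<lambda>w. f (w + P)) contour_integrable_on linepath X A"
    by (simp add: contour_integrable_translate flip: tr)
  have "contour_integral (linepath (X + P) (A + P)) f = contour_integral (linepath X A) (\<lambda>w. f (w + P))"
    by (simp add: contour_integral_translate flip: tr)
  then have "contour_integral (linepath (X + P) (A + P)) f - contour_integral (linepath X A) f =
      contour_integral (linepath X A) (\<lambda>w. f (w + P) - f w)"
    using fi1 fi4 by (simp add: contour_integral_diff)
  also have "\<dots> = contour_integral (linepath X A) (\<lambda>w. k (exp w) * (G (w + P) - G w))"
    by (simp only: f_def exp_plus_2pii right_diff_distrib)
  finally have "contour_integral (linepath (X + P) (A + P)) f - contour_integral (linepath X A) f = \<dots>" .
  \<comment> \<open>Here \<open>s\<close>, \<open>u\<close>, \<open>v\<close>, \<open>c\<close> are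
    the integrals over the lift, the upper side, the vertical side and the lower side, the last
    three directed to the right or upwards.\<close>
  moreover have "s = d + v" if "s + (- u + (- v + c)) = 0" "u - c = d" for s u v c d :: complex
    using that by algebra
  ultimately show "contour_integral (log_lift a g) (\<lambda>w. k (exp w) * G w) =
     contour_integral (linepath X A) (\<lambda>w. k (exp w) * (G (w + P) - G w)) +
     contour_integral (linepath X (X + P)) (\<lambda>w. k (exp w) * G w)"
    using sum0 unfolding f_def[symmetric] rev rev2 by blast
qed

end

section \<open>Asymptotics on small circles\<close>

lemma divergent_terms_zero: "divergent_terms (\<lambda>_. 0)"
  unfolding divergent_terms_def by (rule exI[of _ "{}"]) auto

lemma divergent_terms_monomial:
  assumes "0 \<le> Re \<mu>" "(\<mu>, m) = (0, 0) \<Longrightarrow> c = 0"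
  shows "divergent_terms (\<lambda>\<epsilon>. c * (of_real \<epsilon> powr (- \<mu>) * of_real (ln \<epsilon>) ^ m))"
proof (cases "(\<mu>, m) = (0, 0)")
  case True
  then show ?thesis using assms divergent_terms_zero by simp
next
  case False
  then show ?thesis
    unfolding divergent_terms_def using assms
    by (intro exI[of _ "{(\<mu>, m)}"] exI[of _ "\<lambda>_. c"]) auto
qed

lemma divergent_terms_add:
  assumes "divergent_terms D" "divergent_terms D'"
  shows "divergent_terms (\<lambda>\<epsilon>. D \<epsilon> + D' \<epsilon>)"
proof -
  define u :: "real \<Rightarrow> complex \<times> nat \<Rightarrow> complex" where
    "u = (\<lambda>\<epsilon> (\<mu>, m). of_real \<epsilon> powr (- \<mu>) * of_real (ln \<epsilon>) ^ m)"
  have *: "(\<lambda>(\<mu>, m). c (\<mu>, m) * (of_real \<epsilon> powr (- \<mu>) * of_real (ln \<epsilon>) ^ m)) = (\<lambda>p. c p * u \<epsilon> p)" for c \<epsilon>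
    by (auto simp: u_def)
  obtain S c where S: "finite S" "\<forall>(\<mu>, m)\<in>S. 0 \<le> Re \<mu> \<and> (\<mu>, m) \<noteq> (0, 0)"
    and D: "D = (\<lambda>\<epsilon>. \<Sum>p\<in>S. c p * u \<epsilon> p)"
    using assms(1) unfolding divergent_terms_def * by blast
  obtain S' c' where S': "finite S'" "\<forall>(\<mu>, m)\<in>S'. 0 \<le> Re \<mu> \<and> (\<mu>, m) \<noteq> (0, 0)"
    and D': "D' = (\<lambda>\<epsilon>. \<Sum>p\<in>S'. c' p * u \<epsilon> p)"
    using assms(2) unfolding divergent_terms_def * by blast
  define d where "d = (\<lambda>p. (if p \<in> S then c p else 0) + (if p \<in> S' then c' p else 0))"
  have "D \<epsilon> + D' \<epsilon> = (\<Sum>p\<in>S \<union> S'. d p * u \<epsilon> p)" for \<epsilon>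
  proof -
    have "D \<epsilon> = (\<Sum>p\<in>S \<union> S'. (if p \<in> S then c p else 0) * u \<epsilon> p)"
      unfolding D using S S' by (intro sum.mono_neutral_cong_left) auto
    moreover have "D' \<epsilon> = (\<Sum>p\<in>S \<union> S'. (if p \<in> S' then c' p else 0) * u \<epsilon> p)"
      unfolding D' using S S' by (intro sum.mono_neutral_cong_left) auto
    ultimately show ?thesis by (simp only: d_def distrib_right sum.distrib)
  qed
  then have eq: "(\<lambda>\<epsilon>. D \<epsilon> + D' \<epsilon>) = (\<lambda>\<epsilon>. \<Sum>p\<in>S \<union> S'. d p * u \<epsilon> p)" by blast
  show ?thesis
    unfolding divergent_terms_def * by (intro exI[of _ "S \<union> S'"] exI[of _ d] conjI eq) (use S S' in auto)
qed

lemma divergent_terms_sum: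
  assumes "finite I" "\<And>i. i \<in> I \<Longrightarrow> divergent_terms (D i)"
  shows "divergent_terms (\<lambda>\<epsilon>. \<Sum>i\<in>I. D i \<epsilon>)"
  using assms by (induction I rule: finite_induct) (auto intro: divergent_terms_zero divergent_terms_add)

text \<open>Splits off one factor \<open>z\<close> at a time; the difference quotient of the
  remainder at 0 has a removable singularity. The identity holds for all \<open>z\<close>, also off
  \<open>S\<close>, since it is only the algebra of that quotient.\<close>

lemma holomorphic_taylor_remainder:
  assumes "k holomorphic_on S" "open S"
  obtains c r where "r holomorphic_on S" "\<And>z. k z = (\<Sum>m<b. c m * z ^ m) + z ^ b * r z"
proof -
  have "\<exists>c r. r holomorphic_on S \<and> (\<forall>z. k z = (\<Sum>m<b. c m * z ^ m) + z ^ b * r z)"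
  proof (induction b)
    case 0
    then show ?case using assms by (intro exI[of _ "\<lambda>_. 0"] exI[of _ k]) auto
  next
    case (Suc b)
    then obtain c r where r: "r holomorphic_on S" "\<And>z. k z = (\<Sum>m<b. c m * z ^ m) + z ^ b * r z"
      by blast
    define r' where "r' = (\<lambda>z. if z = 0 then deriv r 0 else (r z - r 0) / (z - 0))"
    have "r' holomorphic_on S" unfolding r'_def by (rule pole_lemma_open[OF r(1) assms(2)])
    moreover have "k z = (\<Sum>m<Suc b. (c(b := r 0)) m * z ^ m) + z ^ Suc b * r' z" for z
    proof -
      have "r z = r 0 + z * r' z" by (simp add: r'_def)
      then have "z ^ b * r z = r 0 * z ^ b + z ^ Suc b * r' z" by (simp add: algebra_simps)
      then show ?thesis using r(2)[of z] by simp
    qed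
    ultimately show ?case by blast
  qed
  then show ?thesis using that by blast
qed

text \<open>Writing \<open>w = X + u\<close> and expanding binomially separates \<open>X\<close>
  from the integration variable. For \<open>\<kappa> = 0\<close> the constant term in
  \<open>X\<close> is \<open>v 0\<close>, the integral of \<open>Q\<close> itself.\<close>

lemma contour_integral_exp_poly:
  fixes c :: "nat \<Rightarrow> complex" and P \<kappa> :: complex and N :: nat
  defines "Q \<equiv> (\<lambda>x. \<Sum>j\<le>N. c j * x ^ j)"
  obtains v where
    "\<And>X. contour_integral (linepath X (X + P)) (\<lambda>w. exp (\<kappa> * w) * Q w) = (\<Sum>i\<le>N. v i * (exp (\<kappa> * X) * X ^ i))"
    "v 0 = contour_integral (linepath 0 P) (\<lambda>w. exp (\<kappa> * w) * Q w)"
proof -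
  \<comment> \<open>The coefficient of \<open>x ^ i\<close> in \<open>Q (x + u)\<close>. For
    \<open>i > j\<close> the binomial is 0, so the truncated exponent \<open>j - i\<close> does no
    harm.\<close>
  define q where "q = (\<lambda>i u. \<Sum>j\<le>N. c j * of_nat (j choose i) * u ^ (j - i))"
  have Q: "Q (x + u) = (\<Sum>i\<le>N. x ^ i * q i u)" for x u
  proof -
    have "Q (x + u) = (\<Sum>j\<le>N. \<Sum>i\<le>N. c j * of_nat (j choose i) * x ^ i * u ^ (j - i))"
      unfolding Q_def
    proof (intro sum.cong refl)
      fix j assume "j \<in> {..N}"
      then have "(\<Sum>i\<le>j. of_nat (j choose i) * x ^ i * u ^ (j - i)) = (\<Sum>i\<le>N. of_nat (j choose i) * x ^ i * u ^ (j - i))"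
        by (intro sum.mono_neutral_left) auto
      then show "c j * (x + u) ^ j = (\<Sum>i\<le>N. c j * of_nat (j choose i) * x ^ i * u ^ (j - i))"
        by (simp add: binomial_ring sum_distrib_left mult.assoc)
    qed
    also have "\<dots> = (\<Sum>i\<le>N. \<Sum>j\<le>N. c j * of_nat (j choose i) * x ^ i * u ^ (j - i))"
      by (rule sum.swap)
    finally show ?thesis by (simp add: q_def sum_distrib_left ac_simps)
  qed
  define v where "v = (\<lambda>i. contour_integral (linepath 0 P) (\<lambda>u. exp (\<kappa> * u) * q i u))"
  have int: "(\<lambda>u. exp (\<kappa> * u) * q i u) contour_integrable_on linepath 0 P" for i
    unfolding q_def by (intro contour_integrable_continuous_linepath continuous_intros)
  show ?thesis
  proof (rule that[of v])
    fix X
    have "contour_integral (linepath X (X + P)) (\<lambda>w. exp (\<kappa> * w) * Q w) =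
        contour_integral ((+) X \<circ> linepath 0 P) (\<lambda>w. exp (\<kappa> * w) * Q w)"
      by (rule arg_cong2[of _ _ _ _ contour_integral]) (auto simp: linepath_def algebra_simps)
    also have "\<dots> = contour_integral (linepath 0 P) (\<lambda>u. \<Sum>i\<le>N. exp (\<kappa> * X) * X ^ i * (exp (\<kappa> * u) * q i u))"
      unfolding contour_integral_translate
      by (simp only: add.commute[of _ X] Q sum_distrib_left distrib_left exp_add) (simp add: ac_simps)
    also have "\<dots> = (\<Sum>i\<le>N. exp (\<kappa> * X) * X ^ i * v i)"
      using int by (subst contour_integral_sum) (auto intro: contour_integrable_lmul simp: contour_integral_lmul v_def)
    finally show "contour_integral (linepath X (X + P)) (\<lambda>w. exp (\<kappa> * w) * Q w) = (\<Sum>i\<le>N. v i * (exp (\<kappa> * X) * X ^ i))"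
      by (simp add: mult.commute)
  next
    have "q 0 u = Q u" for u by (simp add: q_def Q_def)
    then show "v 0 = contour_integral (linepath 0 P) (\<lambda>w. exp (\<kappa> * w) * Q w)" by (simp add: v_def)
  qed
qed

text \<open>With \<open>x = C - ln \<epsilon>\<close> this is \<open>exp C\<close> times
  \<open>x ^ j / exp x\<close> as \<open>x\<close> tends to infinity.\<close>

lemma tendsto_mult_ln_power: "((\<lambda>\<epsilon>::real. \<epsilon> * (C - ln \<epsilon>) ^ j) \<longlongrightarrow> 0) (at_right 0)"
proof -
  have "filterlim (\<lambda>\<epsilon>::real. C - ln \<epsilon>) at_top (at_right 0)" by real_asymp
  from filterlim_compose[OF tendsto_power_div_exp_0[of j] this]
  have lim: "((\<lambda>\<epsilon>. exp C * ((C - ln \<epsilon>) ^ j / exp (C - ln \<epsilon>))) \<longlongrightarrow> exp C * 0) (at_right 0)"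
    by (intro tendsto_intros)
  have "\<forall>\<^sub>F \<epsilon> in at_right 0. exp C * ((C - ln \<epsilon>) ^ j / exp (C - ln \<epsilon>)) = \<epsilon> * (C - ln \<epsilon>) ^ j"
    using eventually_at_right_less[of 0] by eventually_elim (simp add: exp_diff)
  from Lim_transform_eventually[OF lim this] show ?thesis by simp
qed

text \<open>\<open>D\<close> cancels the divergent part of the circle integral. The integral over
  the real segment is a constant minus the circle integral, so \<open>D\<close> is its divergent
  part with the right sign.\<close>

lemma circle_integral_asymptotics:
  assumes k: "k holomorphic_on ball 0 \<rho>" and \<rho>: "0 < \<rho>"
  obtains D where "divergent_terms D"
    "((\<lambda>\<epsilon>. contour_integral (linepath (of_real (ln \<epsilon>)) (of_real (ln \<epsilon>) + 2 * of_real pi * \<i>))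
        (\<lambda>w. k (exp w) * (bern_log n w * exp w / exp w ^ b)) + D \<epsilon>) \<longlongrightarrow> 0) (at_right 0)"
proof -
  define P where "P = 2 * complex_of_real pi * \<i>"
  obtain c r where r: "r holomorphic_on ball 0 \<rho>" "\<And>z. k z = (\<Sum>m<b. c m * z ^ m) + z ^ b * r z"
    using holomorphic_taylor_remainder[OF k open_ball] by metis
  obtain q where q: "bern_log n = (\<lambda>x. \<Sum>j\<le>n + 1. q j * x ^ j)"
    using bern_log_poly by blast
  \<comment> \<open>The exponent \<open>m + 1 - b\<close> for \<open>m < b\<close>: \<open>m\<close>
    from the Taylor term, \<open>- b\<close> from the pole and 1 from
    \<open>dz = exp w dw\<close>.\<close>
  define e where "e = (\<lambda>m. - complex_of_nat (b - 1 - m))"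
  define expands where "expands = (\<lambda>m v.
      (\<forall>X. contour_integral (linepath X (X + P)) (\<lambda>w. exp (e m * w) * bern_log n w) =
        (\<Sum>i\<le>n + 1. v i * (exp (e m * X) * X ^ i))) \<and>
      v 0 = contour_integral (linepath 0 P) (\<lambda>w. exp (e m * w) * bern_log n w))"
  have "\<exists>v. expands m v" for m
    unfolding expands_def q
    by (rule contour_integral_exp_poly[where P = P and \<kappa> = "e m" and N = "n + 1" and c = q]) blast
  then obtain v where "\<And>m. expands m (v m)" by metis
  then have v: "contour_integral (linepath X (X + P)) (\<lambda>w. exp (e m * w) * bern_log n w) =
      (\<Sum>i\<le>n + 1. v m i * (exp (e m * X) * X ^ i))"
    "v m 0 = contour_integral (linepath 0 P) (\<lambda>w. exp (e m * w) * bern_log n w)" for m X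
    unfolding expands_def by blast+
  define D where "D = (\<lambda>\<epsilon>. \<Sum>m<b. \<Sum>i\<le>n + 1. - (c m * v m i) *
      (complex_of_real \<epsilon> powr (- of_nat (b - 1 - m)) * of_real (ln \<epsilon>) ^ i))"
  have D: "divergent_terms D"
    unfolding D_def
  proof (intro divergent_terms_sum divergent_terms_monomial finite_lessThan finite_atMost)
    \<comment> \<open>Among the indices below \<open>b\<close> this is \<open>m = b - 1\<close>,
      \<open>i = 0\<close>, the one constant term. Its coefficient is a multiple of the vanishing
      integral of \<open>bern_log\<close>.\<close>
    fix m i :: nat assume "(complex_of_nat (b - 1 - m), i) = (0, 0)"
    then have "i = 0" "e m = 0" by (auto simp: e_def)
    then have "v m i = contour_integral (linepath 0 P) (bern_log n)" by (simp add: v(2))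
    also have "\<dots> = 0"
      unfolding P_def by (rule contour_integral_unique[OF bern_log_integral])
    finally show "- (c m * v m i) = 0" by simp
  qed auto
  \<comment> \<open>\<open>\<delta> < \<rho>\<close> gives a compact disc on which \<open>r\<close>
    is bounded; \<open>\<delta> \<le> 1\<close> makes \<open>ln \<epsilon>\<close> nonpositive, so
    that \<open>2 * pi - ln \<epsilon>\<close> bounds the norm of \<open>w\<close>.\<close>
  define \<delta> where "\<delta> = min 1 (\<rho> / 2)"
  have \<delta>: "0 < \<delta>" "\<delta> \<le> 1" "\<delta> < \<rho>" using \<rho> by (auto simp: \<delta>_def)
  have "continuous_on (cball 0 \<delta>) r"
    using r(1) \<delta> by (intro holomorphic_on_imp_continuous_on) (auto elim!: holomorphic_on_subset)
  then have "bounded (r ` cball 0 \<delta>)"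
    by (intro compact_imp_bounded compact_continuous_image) auto
  then obtain M where M: "0 < M" "\<forall>y \<in> r ` cball 0 \<delta>. norm y \<le> M"
    unfolding bounded_pos by blast
  define R where "R = (\<lambda>\<epsilon>. contour_integral (linepath (of_real (ln \<epsilon>)) (of_real (ln \<epsilon>) + P))
        (\<lambda>w. k (exp w) * (bern_log n w * exp w / exp w ^ b)) + D \<epsilon>)"
  have bound: "norm (R \<epsilon>) \<le> (M * (\<Sum>j\<le>n + 1. norm (q j) * (\<epsilon> * (2 * pi - ln \<epsilon>) ^ j))) * (2 * pi)"
    if \<epsilon>: "0 < \<epsilon>" "\<epsilon> < \<delta>" for \<epsilon>
  proof -
    define X where "X = complex_of_real (ln \<epsilon>)"
    have Re: "Re w = ln \<epsilon>" and Im: "\<bar>Im w\<bar> \<le> 2 * pi" if "w \<in> closed_segment X (X + P)" for w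
      using that by (auto simp: X_def P_def closed_segment_same_Re closed_segment_eq_real_ivl)
    have ew: "norm (exp w) = \<epsilon>" if "w \<in> closed_segment X (X + P)" for w
      using Re[OF that] \<epsilon> by simp
    have cr: "continuous_on (closed_segment X (X + P)) (\<lambda>w. r (exp w))"
      by (rule continuous_on_compose2[OF \<open>continuous_on (cball 0 \<delta>) r\<close>])
         (use \<epsilon> ew in \<open>auto intro: continuous_on_exp continuous_on_id\<close>)
    have cq: "continuous_on S (bern_log n)" for S
      by (intro holomorphic_on_imp_continuous_on holomorphic_intros)
    have int1: "(\<lambda>w. exp (e m * w) * bern_log n w) contour_integrable_on linepath X (X + P)" for m
      by (intro contour_integrable_continuous_linepath continuous_intros cq)
    have int2: "(\<lambda>w. r (exp w) * exp w * bern_log n w) contour_integrable_on linepath X (X + P)"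
      by (intro contour_integrable_continuous_linepath continuous_intros cq cr)
    \<comment> \<open>In the remainder \<open>z ^ b\<close> cancels the pole, and the factor
      \<open>exp w\<close>, of norm \<open>\<epsilon>\<close>, outweighs the powers of the
      logarithm.\<close>
    have split: "k (exp w) * (bern_log n w * exp w / exp w ^ b) =
        (\<Sum>m<b. c m * (exp (e m * w) * bern_log n w)) + r (exp w) * exp w * bern_log n w" for w
    proof -
      have "exp w ^ m * exp w / exp w ^ b = exp (e m * w)" if "m < b" for m
      proof -
        have "exp w ^ b = exp w ^ (m + 1 + (b - 1 - m))" using that by simp
        then have "exp w ^ b = exp w ^ m * exp w * exp w ^ (b - 1 - m)"
          by (simp only: power_add power_one_right)
        then show ?thesis by (simp add: e_def exp_minus exp_of_nat_mult divide_simps)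
      qed
      then have "(\<Sum>m<b. c m * (exp w ^ m * exp w / exp w ^ b * bern_log n w)) =
          (\<Sum>m<b. c m * (exp (e m * w) * bern_log n w))"
        by (intro sum.cong) auto
      moreover have "k (exp w) * (bern_log n w * exp w / exp w ^ b) =
          (\<Sum>m<b. c m * (exp w ^ m * exp w / exp w ^ b * bern_log n w)) + r (exp w) * exp w * bern_log n w"
        unfolding r(2) distrib_right sum_distrib_right by (simp add: ac_simps)
      ultimately show ?thesis by simp
    qed
    have "contour_integral (linepath X (X + P)) (\<lambda>w. k (exp w) * (bern_log n w * exp w / exp w ^ b)) =
        (\<Sum>m<b. c m * (\<Sum>i\<le>n + 1. v m i * (exp (e m * X) * X ^ i))) +
        contour_integral (linepath X (X + P)) (\<lambda>w. r (exp w) * exp w * bern_log n w)"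
      unfolding split using int1 int2
      by (subst contour_integral_add)
         (auto intro!: contour_integrable_sum contour_integrable_lmul
               simp: contour_integral_sum contour_integral_lmul contour_integrable_lmul v(1))
    also have "(\<Sum>m<b. c m * (\<Sum>i\<le>n + 1. v m i * (exp (e m * X) * X ^ i))) = - D \<epsilon>"
    proof -
      have "exp (e m * X) = complex_of_real \<epsilon> powr (- of_nat (b - 1 - m))" for m
        using \<epsilon> by (simp add: powr_def X_def e_def Ln_of_real)
      then show ?thesis by (simp only: D_def X_def sum_distrib_left mult.assoc mult_minus_left sum_negf minus_minus)
    qed
    finally have "R \<epsilon> = contour_integral (linepath X (X + P)) (\<lambda>w. r (exp w) * exp w * bern_log n w)"
      by (simp add: R_def X_def)
    also have "norm \<dots> \<le> (M * (\<Sum>j\<le>n + 1. norm (q j) * (\<epsilon> * (2 * pi - ln \<epsilon>) ^ j))) * norm (X + P - X)"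
    proof (rule contour_integral_bound_linepath[OF int2])
      have ln: "ln \<epsilon> \<le> 0" using \<epsilon> \<delta> by simp
      then have "0 \<le> 2 * pi - ln \<epsilon>" using pi_gt_zero by linarith
      then show "0 \<le> M * (\<Sum>j\<le>n + 1. norm (q j) * (\<epsilon> * (2 * pi - ln \<epsilon>) ^ j))"
        using M(1) \<epsilon> by (intro mult_nonneg_nonneg sum_nonneg zero_le_power) auto
      fix w assume w: "w \<in> closed_segment X (X + P)"
      have "norm w \<le> 2 * pi - ln \<epsilon>"
        using cmod_le[of w] Re[OF w] Im[OF w] ln by simp
      then have "norm (bern_log n w) \<le> (\<Sum>j\<le>n + 1. norm (q j) * (2 * pi - ln \<epsilon>) ^ j)"
        unfolding q by (intro sum_norm_le) (auto simp: norm_mult norm_power intro!: mult_left_mono power_mono)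
      moreover have "norm (r (exp w)) \<le> M" using M(2) ew[OF w] \<epsilon> by simp
      ultimately have "norm (r (exp w) * exp w * bern_log n w) \<le> M * \<epsilon> * (\<Sum>j\<le>n + 1. norm (q j) * (2 * pi - ln \<epsilon>) ^ j)"
        unfolding norm_mult ew[OF w] using M(1) \<epsilon> by (intro mult_mono) auto
      also have "\<dots> = M * (\<Sum>j\<le>n + 1. norm (q j) * (\<epsilon> * (2 * pi - ln \<epsilon>) ^ j))"
        unfolding mult.assoc sum_distrib_left[of \<epsilon>] by (simp only: mult.left_commute)
      finally show "norm (r (exp w) * exp w * bern_log n w) \<le> M * (\<Sum>j\<le>n + 1. norm (q j) * (\<epsilon> * (2 * pi - ln \<epsilon>) ^ j))" .
    qed
    also have "norm (X + P - X) = 2 * pi" by (simp add: P_def norm_mult)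
    finally show ?thesis .
  qed
  have "((\<lambda>\<epsilon>. (M * (\<Sum>j\<le>n + 1. norm (q j) * (\<epsilon> * (2 * pi - ln \<epsilon>) ^ j))) * (2 * pi)) \<longlongrightarrow>
      (M * (\<Sum>j\<le>n + 1. norm (q j) * 0)) * (2 * pi)) (at_right 0)"
    by (intro tendsto_intros tendsto_mult_ln_power)
  then have "(R \<longlongrightarrow> 0) (at_right 0)"
    using eventually_mono[OF eventually_at_right_real[OF \<delta>(1)]] bound
    by (intro Lim_null_comparison[of R]) (auto elim!: eventually_mono)
  then show ?thesis
    using that[OF D] unfolding R_def P_def by simp
qed

section \<open>The finite part\<close>

text \<open>The real substitution \<open>t = exp x\<close>, for which only the values of
  \<open>F\<close> on the real axis matter.\<close>

lemma contour_integral_log_segment: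
  assumes \<epsilon>: "0 < \<epsilon>" "\<epsilon> < a" and h: "continuous_on {\<epsilon>..a} h"
    and F: "\<And>x. F (of_real x) = h (exp x) * of_real (exp x)"
  shows "contour_integral (linepath (of_real (ln \<epsilon>)) (of_real (ln a))) F = integral {\<epsilon>..a} h"
proof -
  have l: "ln \<epsilon> < ln a" using \<epsilon> by simp
  have "((\<lambda>x. exp x *\<^sub>R h (exp x)) has_integral integral {exp (ln \<epsilon>)..exp (ln a)} h) {ln \<epsilon>..ln a}"
  proof (rule has_integral_substitution[where c = \<epsilon> and d = a])
    show "exp ` {ln \<epsilon>..ln a} \<subseteq> {\<epsilon>..a}"
      using \<epsilon> by (auto simp: ln_le_cancel_iff ln_ge_iff) (metis exp_le_cancel_iff exp_ln less_trans)
  qed (use \<epsilon> l h in \<open>auto intro!: derivative_eq_intros\<close>)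
  then have "((\<lambda>x. F (of_real x)) has_integral integral {\<epsilon>..a} h) {ln \<epsilon>..ln a}"
    using \<epsilon> by (simp add: F scaleR_conv_of_real mult.commute)
  then have "integral {ln \<epsilon>..ln a} (\<lambda>x. F (of_real x)) = integral {\<epsilon>..a} h"
    by (rule integral_unique)
  then show ?thesis
    by (subst contour_integral_linepath_Reals_eq) (use l in auto)
qed

theorem theorem3p3:
  fixes a :: real and k :: "complex \<Rightarrow> complex" and n b :: nat and g :: "real \<Rightarrow> complex"
  assumes "0 < a"
    and "k analytic_on (complex_of_real ` {0..a})"
    and "k 0 \<noteq> 0"
    and "n > 0"
    and "b > 0"
    and "cut_contour k a g"
  shows "(\<exists>L. has_finite_part_integral (\<lambda>t. k (of_real t) * of_real (ln t) ^ n / of_real t ^ b) L a) \<and>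
    finite_part_integral a (\<lambda>t. k (of_real t) * of_real (ln t) ^ n / of_real t ^ b) =
      1 / (2 * of_real pi * \<i> * of_nat (n + 1)) *
        contour_integral g (\<lambda>z. k z / z ^ b * ln_cut z ^ (n + 1)) +
      (\<Sum>j=0..n. of_nat (n choose j) * (2 * of_real pi * \<i>) ^ (n - j) *
        (of_real (bernoulli (n - j + 1)) / of_nat (n - j + 1)) *
        contour_integral g (\<lambda>z. k z / z ^ b * ln_cut z ^ j))"
    (is "_ \<and> _ = ?rhs")
proof -
  define h where "h = (\<lambda>t. k (of_real t) * of_real (ln t) ^ n / complex_of_real t ^ b)"
  define P where "P = 2 * complex_of_real pi * \<i>"
  \<comment> \<open>The Jacobian \<open>exp w\<close> is included, so \<open>G\<close> is entire and
    \<open>k (exp w)\<close> is the only factor that restricts the domain.\<close>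
  define G where "G = (\<lambda>w. bern_log n w * exp w / exp w ^ b)"
  define circ where "circ = (\<lambda>\<epsilon>. contour_integral (linepath (of_real (ln \<epsilon>)) (of_real (ln \<epsilon>) + P)) (\<lambda>w. k (exp w) * G w))"
  note k_seg = assms(2) and cc = assms(6)
  have "k analytic_on {0}" using k_seg assms(1) by (auto elim!: analytic_on_subset)
  then obtain \<rho> where \<rho>: "\<rho> > 0" "k holomorphic_on ball 0 \<rho>"
    by (auto simp: analytic_on_def)
  have k_ball: "k analytic_on cball 0 \<epsilon>" if "\<epsilon> < \<rho>" for \<epsilon>
  proof -
    have "k analytic_on ball 0 \<rho>" using \<rho> by (simp add: analytic_on_open)
    then show ?thesis using that by (auto elim!: analytic_on_subset)
  qed
  have G_holo: "G holomorphic_on UNIV"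
    unfolding G_def by (intro holomorphic_intros) auto

  have int: "(\<lambda>z. k z / z ^ b * ln_cut z ^ j) contour_integrable_on g" for j
  proof -
    \<comment> \<open>Any radius within both \<open>a\<close> and the disc of analyticity serves
      here, since only the integrability claim is taken from Cauchy's theorem.\<close>
    define \<epsilon> where "\<epsilon> = min a (\<rho> / 2)"
    have \<epsilon>: "0 < \<epsilon>" "\<epsilon> \<le> a" "\<epsilon> < \<rho>" using \<rho> assms(1) by (auto simp: \<epsilon>_def)
    have "(\<lambda>w. k (exp w) * (w ^ j * exp w / exp w ^ b)) contour_integrable_on log_lift a g"
      by (rule contour_integral_log_lift(2)[OF \<epsilon>(1,2) cc k_seg k_ball[OF \<epsilon>(3)]])
         (intro holomorphic_intros, auto)
    then have "(\<lambda>w. k (exp w) / exp w ^ b * w ^ j * exp w) contour_integrable_on log_lift a g"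
      by (simp add: ac_simps)
    then show ?thesis
      using has_contour_integral_log_lift[OF assms(1) cc, of "\<lambda>z l. k z / z ^ b * l ^ j"]
      unfolding contour_integrable_on_def by simp
  qed
  have rhs: "?rhs = contour_integral (log_lift a g) (\<lambda>w. k (exp w) * G w)"
  proof -
    define s where "s = (\<lambda>j. of_nat (n choose j) * P ^ (n - j) * (of_real (bernoulli (n - j + 1)) / of_nat (n - j + 1)))"
    have "((\<lambda>z. 1 / (P * of_nat (n + 1)) * (k z / z ^ b * ln_cut z ^ (n + 1)) +
        (\<Sum>j=0..n. s j * (k z / z ^ b * ln_cut z ^ j))) has_contour_integral ?rhs) g"
      unfolding s_def P_def
      by (intro has_contour_integral_add has_contour_integral_lmul has_contour_integral_sum
            has_contour_integral_integral int finite_atLeastAtMost)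
    moreover have "1 / (P * of_nat (n + 1)) * (k z / z ^ b * l ^ (n + 1)) +
        (\<Sum>j=0..n. s j * (k z / z ^ b * l ^ j)) = k z / z ^ b * bern_log n l" for z l
      unfolding bern_log_expand s_def P_def distrib_left sum_distrib_left by (simp add: ac_simps)
    ultimately have "((\<lambda>z. k z / z ^ b * bern_log n (ln_cut z)) has_contour_integral ?rhs) g"
      by simp
    then have "((\<lambda>w. k (exp w) / exp w ^ b * bern_log n w * exp w) has_contour_integral ?rhs) (log_lift a g)"
      using has_contour_integral_log_lift[OF assms(1) cc, of "\<lambda>z l. k z / z ^ b * bern_log n l"] by simp
    then have "contour_integral (log_lift a g) (\<lambda>w. k (exp w) / exp w ^ b * bern_log n w * exp w) = ?rhs"
      by (rule contour_integral_unique)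
    then show ?thesis by (simp add: G_def ac_simps)
  qed
  have h_cont: "continuous_on {\<epsilon>..a} h" if "0 < \<epsilon>" for \<epsilon>
  proof -
    have "continuous_on (complex_of_real ` {0..a}) k"
      using k_seg by (intro holomorphic_on_imp_continuous_on analytic_imp_holomorphic)
    then have "continuous_on {\<epsilon>..a} (\<lambda>t. k (of_real t))"
      by (rule continuous_on_compose2) (use that in \<open>auto intro: continuous_on_of_real_id\<close>)
    then show ?thesis
      unfolding h_def using that by (intro continuous_intros) auto
  qed
  have key: "integral {\<epsilon>..a} h = ?rhs - circ \<epsilon>" if \<epsilon>: "0 < \<epsilon>" "\<epsilon> < a" "\<epsilon> < \<rho>" for \<epsilon>
  proof -
    have "?rhs = contour_integral (linepath (of_real (ln \<epsilon>)) (of_real (ln a))) (\<lambda>w. k (exp w) * (G (w + P) - G w)) + circ \<epsilon>"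
      unfolding rhs circ_def P_def
      by (rule contour_integral_log_lift(1)[OF \<epsilon>(1) less_imp_le[OF \<epsilon>(2)] cc k_seg k_ball[OF \<epsilon>(3)] G_holo])
    also have "contour_integral (linepath (of_real (ln \<epsilon>)) (of_real (ln a))) (\<lambda>w. k (exp w) * (G (w + P) - G w)) = integral {\<epsilon>..a} h"
    proof (rule contour_integral_log_segment[OF \<epsilon>(1,2) h_cont[OF \<epsilon>(1)]])
      fix x
      have "G (of_real x + P) - G (of_real x) =
          (bern_log n (of_real x + P) - bern_log n (of_real x)) * exp (of_real x) / exp (of_real x) ^ b"
        unfolding G_def P_def exp_plus_2pii by (simp only: left_diff_distrib diff_divide_distrib)
      also have "\<dots> = of_real x ^ n * exp (of_real x) / exp (of_real x) ^ b"
        by (simp only: P_def bern_log_shift)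
      finally show "k (exp (of_real x)) * (G (of_real x + P) - G (of_real x)) = h (exp x) * of_real (exp x)"
        by (simp add: h_def exp_of_real)
    qed
    finally show ?thesis by simp
  qed
  obtain D where D: "divergent_terms D" "((\<lambda>\<epsilon>. circ \<epsilon> + D \<epsilon>) \<longlongrightarrow> 0) (at_right 0)"
    unfolding circ_def G_def P_def
    by (rule circle_integral_asymptotics[OF \<rho>(2,1), where n = n and b = b]) blast
  have "has_finite_part_integral h ?rhs a"
    unfolding has_finite_part_integral_def
  proof (intro conjI)
    show "\<forall>\<epsilon>\<in>{0<..<a}. h integrable_on {\<epsilon>..a}"
      using h_cont by (auto intro!: integrable_continuous_real)
    have lim: "((\<lambda>\<epsilon>. ?rhs - (circ \<epsilon> + D \<epsilon>)) \<longlongrightarrow> ?rhs - 0) (at_right 0)"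
      by (intro tendsto_intros D(2))
    have "\<forall>\<^sub>F \<epsilon> in at_right 0. ?rhs - (circ \<epsilon> + D \<epsilon>) = integral {\<epsilon>..a} h - D \<epsilon>"
      using eventually_at_right_real[OF assms(1)] eventually_at_right_real[OF \<rho>(1)]
    proof eventually_elim
      case (elim \<epsilon>)
      then have "integral {\<epsilon>..a} h = ?rhs - circ \<epsilon>" by (intro key) auto
      then show ?case by (simp only: diff_diff_eq)
    qed
    from Lim_transform_eventually[OF lim this]
    have "((\<lambda>\<epsilon>. integral {\<epsilon>..a} h - D \<epsilon>) \<longlongrightarrow> ?rhs) (at_right 0)" by (simp only: diff_zero)
    \<comment> \<open>Taking the convergent part as the integral minus \<open>D\<close> makes the
      decomposition hold on all of \<open>{0<..<a}\<close>, although \<open>key\<close> covers only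
      \<open>\<epsilon> < \<rho>\<close>; the limit needs no more.\<close>
    moreover have "\<forall>\<epsilon>\<in>{0<..<a}. integral {\<epsilon>..a} h = integral {\<epsilon>..a} h - D \<epsilon> + D \<epsilon>" by simp
    ultimately show "\<exists>C D. (\<forall>\<epsilon>\<in>{0<..<a}. integral {\<epsilon>..a} h = C \<epsilon> + D \<epsilon>) \<and>
        divergent_terms D \<and> (C \<longlongrightarrow> ?rhs) (at_right 0)"
      using D(1) by (intro exI[of _ D] exI[of _ "\<lambda>\<epsilon>. integral {\<epsilon>..a} h - D \<epsilon>"] conjI)
  qed
  then show ?thesis
    using finite_part_integral_eqI[OF _ assms(1)] unfolding h_def by blast
qed

end
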